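(* Let $k\ge 1$ be an integer and let $q=\{q_n\}_{n=-\infty}^{\infty}$ be a complex sequence with $q\in l^{2,k}$ and $\|q\|_\infty=\sup_n|q_n|<1$. Then the reflection coefficient $r(\theta)=b(e^{i\theta})/a(e^{i\theta})$ associated with $q$ belongs to $H^k_\theta(\Sigma)$.
   Context: $l^{2,k}$ is the space of complex sequences with $\sum_{n\in\mathbb Z}(1+n^2)^k|q_n|^2<\infty$. $\Sigma=\{z=e^{i\theta}:\theta\in[-\pi,\pi]\}$ is the unit circle; functions on $\Sigma$ are written as functions of $z$ or of $\theta$. $H^k_\theta=H^k_\theta(\Sigma)=\{f\in L^2_\theta(\Sigma):\partial_\theta^\alpha f\in L^2_\theta(\Sigma),\ \alpha=1,\dots,k\}$ (periodic Sobolev space on the circle), with norm $\|f\|_{H^k_\theta}=\big(\sum_{n}(1+n^2)^k|\hat f(n)|^2\big)^{1/2}$, $\hat f(n)=\frac1{2\pi}\int_{-\pi}^{\pi}f(\theta)e^{-in\theta}\,d\theta$. Let $\sigma_3=\begin{pmatrix}1&0\\0&-1\end{pmatrix}$, $Q_n=\begin{pmatrix}0&q_n\\ \bar q_n&0\end{pmatrix}$. For $z\in\Sigma$ the Jost solutions $X^{(\pm)}(z,n)$ are the $2\times2$ matrix solutions of the spectral problem $X(z,n+1)=(z^{\sigma_3}+Q_n)X(z,n)$, $n\in\mathbb Z$, with $X^{(\pm)}(z,n)\sim z^{n\sigma_3}$ (that is, $z^{-n\sigma_3}X^{(\pm)}(z,n)\to I$) as $n\to\pm\infty$. They are invertible,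 and the scattering matrix $S(z)$, independent of $n$, is defined by $X^{(-)}(z,n)=X^{(+)}(z,n)S(z)$. Here $a(z)=S_{11}(z)$ and $b(z)=S_{21}(z)$; one has $|a(z)|^2-|b(z)|^2=\prod_{n=-\infty}^{\infty}(1-|q_n|^2)>0$ on $\Sigma$, so $a\ne0$ on $\Sigma$ and $r=b/a$ is well defined. *)

theory Defs
  imports "HOL-Analysis.Analysis"
begin

definition l2_weighted :: "nat \<Rightarrow> (int \<Rightarrow> complex) set" where
  "l2_weighted k =
     {q. (\<lambda>n. (1 + (real_of_int n)\<^sup>2) ^ k * (cmod (q n))\<^sup>2) summable_on UNIV}"

text \<open>
  Functions on the unit circle are represented as functions of the angle; only their values
  on \<open>[-\<pi>, \<pi>]\<close> matter.
\<close>

definition L2_circle :: "(real \<Rightarrow> complex) set" where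
  "L2_circle =
     {f. f \<in> borel_measurable (lebesgue_on {-pi..pi}) \<and>
         integrable (lebesgue_on {-pi..pi}) (\<lambda>\<theta>. (cmod (f \<theta>))\<^sup>2)}"

definition nth_vector_derivative :: "nat \<Rightarrow> (real \<Rightarrow> complex) \<Rightarrow> real \<Rightarrow> complex" where
  "nth_vector_derivative m = (\<lambda>f x. vector_derivative f (at x)) ^^ m"

definition smooth_periodic :: "(real \<Rightarrow> complex) set" where
  "smooth_periodic =
     {\<phi>. (\<forall>m x. nth_vector_derivative m \<phi> differentiable (at x)) \<and>
         (\<forall>x. \<phi> (x + 2 * pi) = \<phi> x)}"

text \<open>
  \<open>g\<close> is the distributional derivative of order \<open>\<alpha>\<close> of \<open>f\<close> on the circle. The test functions
  are periodic and need not vanish at \<open>\<plusminus>\<pi>\<close>, so a jump of \<open>f\<close> across the point \<open>-1\<close> of the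
  circle is not allowed.
\<close>

definition weak_derivative_circle ::
    "nat \<Rightarrow> (real \<Rightarrow> complex) \<Rightarrow> (real \<Rightarrow> complex) \<Rightarrow> bool" where
  "weak_derivative_circle \<alpha> f g \<longleftrightarrow>
     (\<forall>\<phi> \<in> smooth_periodic.
        integral\<^sup>L (lebesgue_on {-pi..pi}) (\<lambda>\<theta>. f \<theta> * nth_vector_derivative \<alpha> \<phi> \<theta>) =
        (-1) ^ \<alpha> * integral\<^sup>L (lebesgue_on {-pi..pi}) (\<lambda>\<theta>. g \<theta> * \<phi> \<theta>))"

definition sobolev_circle :: "nat \<Rightarrow> (real \<Rightarrow> complex) set" where
  "sobolev_circle k =
     {f \<in> L2_circle. \<forall>\<alpha> \<in> {1..k}. \<exists>g \<in> L2_circle. weak_derivative_circle \<alpha> f g}"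

text \<open>The matrix \<open>z\<close> to the power \<open>n \<sigma>\<^sub>3\<close>.\<close>

definition z_sigma3 :: "complex \<Rightarrow> int \<Rightarrow> complex^2^2" where
  "z_sigma3 z n = vector [vector [z powi n, 0], vector [0, z powi (- n)]]"

definition potential :: "(int \<Rightarrow> complex) \<Rightarrow> int \<Rightarrow> complex^2^2" where
  "potential q n = vector [vector [0, q n], vector [cnj (q n), 0]]"

definition spectral_solution ::
    "(int \<Rightarrow> complex) \<Rightarrow> complex \<Rightarrow> (int \<Rightarrow> complex^2^2) \<Rightarrow> bool" where
  "spectral_solution q z X \<longleftrightarrow>
     (\<forall>n. X (n + 1) = (z_sigma3 z 1 + potential q n) ** X n)"

text \<open>
  For \<open>z\<close> on the unit circle and summable \<open>q\<close> with \<open>|q n| < 1\<close>, the solutions and the matrix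
  described below exist and are unique; otherwise the descriptions may be unspecified.
\<close>

definition jost_plus :: "(int \<Rightarrow> complex) \<Rightarrow> complex \<Rightarrow> int \<Rightarrow> complex^2^2" where
  "jost_plus q z =
     (THE X. spectral_solution q z X \<and>
             ((\<lambda>n. z_sigma3 z (- n) ** X n) \<longlongrightarrow> mat 1) at_top)"

definition jost_minus :: "(int \<Rightarrow> complex) \<Rightarrow> complex \<Rightarrow> int \<Rightarrow> complex^2^2" where
  "jost_minus q z =
     (THE X. spectral_solution q z X \<and>
             ((\<lambda>n. z_sigma3 z (- n) ** X n) \<longlongrightarrow> mat 1) at_bot)"

definition scattering_matrix :: "(int \<Rightarrow> complex) \<Rightarrow> complex \<Rightarrow> complex^2^2" where
  "scattering_matrix q z = (THE S. \<forall>n. jost_minus q z n = jost_plus q z n ** S)"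

definition scattering_a :: "(int \<Rightarrow> complex) \<Rightarrow> complex \<Rightarrow> complex" where
  "scattering_a q z = scattering_matrix q z $ 1 $ 1"

definition scattering_b :: "(int \<Rightarrow> complex) \<Rightarrow> complex \<Rightarrow> complex" where
  "scattering_b q z = scattering_matrix q z $ 2 $ 1"

definition reflection_coeff :: "(int \<Rightarrow> complex) \<Rightarrow> real \<Rightarrow> complex" where
  "reflection_coeff q \<theta> = scattering_b q (cis \<theta>) / scattering_a q (cis \<theta>)"

end

theory Submission
  imports Defs
begin

text \<open>
  Truncating the potential to \<open>-N \<le> n < N\<close> turns \<open>a\<close> and \<open>b\<close> into trigonometric polynomials. It
  suffices that these converge in the Sobolev norm: the derivatives of order below \<open>k\<close> uniformly,
  the last one in the mean square sense. The quotients then do the same, since the determinant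
  relation bounds \<open>a\<close> away from zero.

  For a half line let \<open>\<Phi>\<^sub>N\<close> be the product of the first \<open>N\<close> transfer matrices \<open>I + A\<^sub>n\<close>. Variation of
  constants gives \<open>\<Phi>\<^sub>N' = \<Phi>\<^sub>N Z\<^sub>N\<close>, where \<open>Z\<^sub>N\<close> is the sum of \<open>\<Phi>\<^bsub>n+1\<^esub>\<close> to the power \<open>-1\<close> times
  \<open>A\<^sub>n' \<Phi>\<^sub>n\<close> over \<open>n < N\<close>. The entries of \<open>Z\<^sub>N\<close> are sums of terms
  \<open>n q\<^sub>n e\<^bsup>\<plusminus>i(2n+1)\<theta>\<^esup>\<close> times products of entries of \<open>\<Phi>\<close>, and those have summable increments. Each
  pass through this formula therefore gains one derivative. All passes but the last use that
  \<open>|n|\<^sup>i q\<^sub>n\<close> is absolutely summable for \<open>i < k\<close>; the last one, where only square summability is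
  left, uses Abel summation and the orthogonality of the exponentials.
\<close>

section \<open>Sequences converging in the Sobolev norm\<close>

text \<open>The obstacle: the last derivative is controlled only in mean square, and a product of
  two mean square limits need not be one. Differentiating the expanded product of transfer matrices
  would leave nested sums with the weight n spread over many factors; the formula with Z keeps it in
  a single sum. The remaining factors need more than uniform convergence: Abel summation moves
  differences onto them, so the sup norms of their increments have to be summable.

  Splitting off 1/(2n+1) by Cauchy-Schwarz turns square summability with weight k into absolute
  summability with weight k - 1. Hence k - 1 passes are uniform and one is not. Two mean square
  factors would meet only in a product of two derivatives of top order, and for k \<ge> 1 the
  Leibniz rule never produces it.

  A solution normalised to the identity at site 0 lets both half lines start alike. If L and M are
  its limits at the two ends, after removal of the free evolution, then S is L times the inverse of
  M.\<close>

abbreviation circle_measure :: "real measure" where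
  "circle_measure \<equiv> lebesgue_on {-pi..pi}"

definition continuous_periodic :: "(real \<Rightarrow> complex) \<Rightarrow> bool" where
  "continuous_periodic f \<longleftrightarrow> continuous_on UNIV f \<and> (\<forall>x. f (x + 2 * pi) = f x)"

definition energy :: "(real \<Rightarrow> complex) \<Rightarrow> real" where
  "energy f = integral\<^sup>L circle_measure (\<lambda>x. (cmod (f x))\<^sup>2)"

definition L2_cauchy :: "(nat \<Rightarrow> real \<Rightarrow> complex) \<Rightarrow> bool" where
  "L2_cauchy f \<longleftrightarrow> (\<forall>n. continuous_periodic (f n)) \<and>
     (\<forall>e>0. \<exists>N. \<forall>m\<ge>N. \<forall>n\<ge>N. energy (\<lambda>x. f m x - f n x) < e)"

text \<open>The sup norms of the increments are required to be summable because
  \<open>L2_cauchy_lacunary_sum\<close> integrates them against partial sums of exponentials. The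
  uniform bound makes the notion stable under products.\<close>

definition uniform_variation :: "(nat \<Rightarrow> real \<Rightarrow> complex) \<Rightarrow> bool" where
  "uniform_variation f \<longleftrightarrow> (\<forall>n. continuous_periodic (f n)) \<and>
     (\<exists>K. \<forall>n x. cmod (f n x) \<le> K) \<and>
     (\<exists>s. summable s \<and> (\<forall>n x. cmod (f (Suc n) x - f n x) \<le> s n))"

text \<open>\<open>P\<close> governs only the derivative of top order; all lower ones have uniform
  variation. The two choices of \<open>P\<close> give convergence as in C^k and as in H^k, and the
  algebra is shared between them.\<close>

primrec deriv_class ::
    "((nat \<Rightarrow> real \<Rightarrow> complex) \<Rightarrow> bool) \<Rightarrow> nat \<Rightarrow> (nat \<Rightarrow> real \<Rightarrow> complex) \<Rightarrow> bool" where
  "deriv_class P 0 f = P f"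
| "deriv_class P (Suc k) f = (uniform_variation f \<and>
     (\<exists>g. (\<forall>n x. (f n has_vector_derivative g n x) (at x)) \<and> deriv_class P k g))"

abbreviation "var_class \<equiv> deriv_class uniform_variation"
abbreviation "L2_class \<equiv> deriv_class L2_cauchy"

section \<open>Continuous periodic functions and their squared norm\<close>

lemma continuous_periodic_add:
  "continuous_periodic f \<Longrightarrow> continuous_periodic g \<Longrightarrow> continuous_periodic (\<lambda>x. f x + g x)"
  by (auto simp: continuous_periodic_def intro!: continuous_intros)

lemma continuous_periodic_diff:
  "continuous_periodic f \<Longrightarrow> continuous_periodic g \<Longrightarrow> continuous_periodic (\<lambda>x. f x - g x)"
  by (auto simp: continuous_periodic_def intro!: continuous_intros)

lemma continuous_periodic_mult:
  "continuous_periodic f \<Longrightarrow> continuous_periodic g \<Longrightarrow> continuous_periodic (\<lambda>x. f x * g x)"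
  by (auto simp: continuous_periodic_def intro!: continuous_intros)

lemma continuous_periodic_cnj:
  "continuous_periodic f \<Longrightarrow> continuous_periodic (\<lambda>x. cnj (f x))"
  by (auto simp: continuous_periodic_def intro!: continuous_intros)

lemma continuous_periodic_inverse:
  "continuous_periodic f \<Longrightarrow> (\<And>x. f x \<noteq> 0) \<Longrightarrow> continuous_periodic (\<lambda>x. inverse (f x))"
  by (auto simp: continuous_periodic_def intro!: continuous_intros)

lemma continuous_periodic_const: "continuous_periodic (\<lambda>x. c)"
  by (auto simp: continuous_periodic_def)

lemma continuous_periodic_sum:
  "(\<And>i. i \<in> I \<Longrightarrow> continuous_periodic (f i)) \<Longrightarrow> continuous_periodic (\<lambda>x. \<Sum>i\<in>I. f i x)"
  by (auto simp: continuous_periodic_def intro!: continuous_intros)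

lemma cis_periodic_int: "cis (real_of_int w * (x + 2 * pi)) = cis (real_of_int w * x)"
proof -
  have "cis (real_of_int w * (x + 2 * pi)) = cis (real_of_int w * x) * cis (2 * pi * real_of_int w)"
    by (simp add: cis_mult algebra_simps)
  then show ?thesis by simp
qed

lemma continuous_periodic_cis: "continuous_periodic (\<lambda>x. cis (real_of_int w * x))"
  by (auto simp: continuous_periodic_def cis_periodic_int intro!: continuous_intros)

lemma integrable_circle:
  fixes f :: "real \<Rightarrow> 'b::euclidean_space"
  shows "continuous_on UNIV f \<Longrightarrow> integrable circle_measure f"
  using continuous_imp_integrable_real continuous_on_subset by blast

lemma integrable_energy: "continuous_periodic f \<Longrightarrow> integrable circle_measure (\<lambda>x. (cmod (f x))\<^sup>2)"
  unfolding continuous_periodic_def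
  by (intro integrable_circle continuous_on_power continuous_on_norm) auto

lemma measure_circle: "measure circle_measure (space circle_measure) = 2 * pi"
  by (simp add: measure_restrict_space)

lemma finite_measure_circle: "finite_measure circle_measure"
  by (simp add: finite_measure_lebesgue_on)

lemma integral_const_circle: "integral\<^sup>L circle_measure (\<lambda>x. c::real) = 2 * pi * c"
  using measure_circle by simp

lemma energy_nonneg: "energy f \<ge> 0"
  unfolding energy_def by simp

text \<open>The bound (u + v)^2 \<le> 2 u^2 + 2 v^2 stands in for the triangle inequality, so only
  squared norms occur; this is the source of the factors 2 in later constants.\<close>

lemma energy_add:
  assumes "continuous_periodic f" "continuous_periodic g"
  shows "energy (\<lambda>x. f x + g x) \<le> 2 * energy f + 2 * energy g"
proof -
  have *: "(cmod (u + v))\<^sup>2 \<le> 2 * (cmod u)\<^sup>2 + 2 * (cmod v)\<^sup>2" for u v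
  proof -
    have "(cmod (u + v))\<^sup>2 \<le> (cmod u + cmod v)\<^sup>2"
      by (simp add: norm_triangle_ineq power_mono)
    also have "\<dots> \<le> 2 * (cmod u)\<^sup>2 + 2 * (cmod v)\<^sup>2"
      using sum_squares_bound[of "cmod u" "cmod v"] by (simp add: power2_sum)
    finally show ?thesis .
  qed
  have "energy (\<lambda>x. f x + g x) \<le>
      integral\<^sup>L circle_measure (\<lambda>x. 2 * (cmod (f x))\<^sup>2 + 2 * (cmod (g x))\<^sup>2)"
    unfolding energy_def
    by (rule integral_mono)
       (auto intro!: integrable_energy continuous_periodic_add assms * Bochner_Integration.integrable_add
           integrable_mult_right)
  also have "\<dots> = 2 * energy f + 2 * energy g"
    unfolding energy_def using integrable_energy assms by simp
  finally show ?thesis .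
qed

lemma energy_bound:
  assumes "continuous_periodic f" "\<And>x. cmod (f x) \<le> B"
  shows "energy f \<le> 2 * pi * B\<^sup>2"
proof -
  have "energy f \<le> integral\<^sup>L circle_measure (\<lambda>x. B\<^sup>2)"
    unfolding energy_def
  proof (rule integral_mono)
    show "(cmod (f x))\<^sup>2 \<le> B\<^sup>2" for x
      by (rule power_mono) (simp_all add: assms(2))
  qed (simp_all add: integrable_energy assms(1) integrable_circle)
  also have "\<dots> = 2 * pi * B\<^sup>2" by (rule integral_const_circle)
  finally show ?thesis .
qed

lemma energy_mult_le:
  assumes "continuous_periodic f" "continuous_periodic g" "\<And>x. cmod (g x) \<le> B"
  shows "energy (\<lambda>x. f x * g x) \<le> B\<^sup>2 * energy f"
proof -
  have "energy (\<lambda>x. f x * g x) \<le> integral\<^sup>L circle_measure (\<lambda>x. B\<^sup>2 * (cmod (f x))\<^sup>2)"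
    unfolding energy_def
  proof (rule integral_mono)
    show "(cmod (f x * g x))\<^sup>2 \<le> B\<^sup>2 * (cmod (f x))\<^sup>2" for x
      using assms(3)[of x]
      by (simp add: norm_mult power_mult_distrib mult.commute[of "B\<^sup>2"] mult_left_mono power_mono)
  qed (intro integrable_energy continuous_periodic_mult assms integrable_mult_right)+
  then show ?thesis by (simp add: energy_def)
qed

section \<open>Algebra of sequences of uniform variation\<close>

lemma uniform_variationI:
  assumes "\<And>n. continuous_periodic (f n)" "\<And>n x. cmod (f n x) \<le> K"
    "summable s" "\<And>n x. cmod (f (Suc n) x - f n x) \<le> s n"
  shows "uniform_variation f"
  unfolding uniform_variation_def using assms by blast

lemma uniform_variationE:
  assumes "uniform_variation f"
  obtains K s where "\<And>n. continuous_periodic (f n)" "\<And>n x. cmod (f n x) \<le> K" "K \<ge> 0"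
    "summable s" "\<And>n x. cmod (f (Suc n) x - f n x) \<le> s n" "\<And>n. s n \<ge> 0"
proof -
  from assms obtain K s where 1: "\<And>n. continuous_periodic (f n)" "\<And>n x. cmod (f n x) \<le> K"
    "summable s" "\<And>n x. cmod (f (Suc n) x - f n x) \<le> s n"
    unfolding uniform_variation_def by blast
  have "K \<ge> 0" using 1(2)[of 0 0] norm_ge_zero order_trans by blast
  moreover have "s n \<ge> 0" for n using 1(4)[of n 0] norm_ge_zero order_trans by blast
  ultimately show ?thesis using that 1 by blast
qed

lemma uniform_variation_bounded_increments:
  assumes "\<And>n. continuous_periodic (f n)" "\<And>x. f 0 x = 0"
    "summable s" "\<And>n x. cmod (f (Suc n) x - f n x) \<le> s n"
  shows "uniform_variation f"
proof (rule uniform_variationI)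
  show "cmod (f n x) \<le> suminf s" for n x
  proof -
    have nn: "s n \<ge> 0" for n using assms(4)[of n 0] norm_ge_zero order_trans by blast
    have "cmod (f n x) \<le> sum s {..<n}"
    proof (induction n)
      case (Suc n)
      have "cmod (f (Suc n) x) \<le> cmod (f n x) + cmod (f (Suc n) x - f n x)"
        by (metis add.commute diff_add_cancel norm_triangle_ineq)
      also have "\<dots> \<le> sum s {..<Suc n}" using Suc assms(4)[of n x] by simp
      finally show ?case .
    qed (simp add: assms(2))
    also have "\<dots> \<le> suminf s" using sum_le_suminf[OF assms(3)] nn by simp
    finally show ?thesis .
  qed
qed (use assms in auto)

lemma uniform_variation_add:
  assumes "uniform_variation f" "uniform_variation g"
  shows "uniform_variation (\<lambda>n x. f n x + g n x)"
proof -
  obtain K s where f: "\<And>n. continuous_periodic (f n)" "\<And>n x. cmod (f n x) \<le> K" "K \<ge> 0"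
    "summable s" "\<And>n x. cmod (f (Suc n) x - f n x) \<le> s n" "\<And>n. s n \<ge> 0"
    using uniform_variationE[OF assms(1)] by metis
  obtain L t where g: "\<And>n. continuous_periodic (g n)" "\<And>n x. cmod (g n x) \<le> L" "L \<ge> 0"
    "summable t" "\<And>n x. cmod (g (Suc n) x - g n x) \<le> t n" "\<And>n. t n \<ge> 0"
    using uniform_variationE[OF assms(2)] by metis
  show ?thesis
  proof (rule uniform_variationI)
    show "cmod (f n x + g n x) \<le> K + L" for n x
      by (intro norm_triangle_mono f g)
    show "cmod (f (Suc n) x + g (Suc n) x - (f n x + g n x)) \<le> s n + t n" for n x
      using norm_triangle_mono[OF f(5) g(5), of n x n x] by (simp add: algebra_simps)
  qed (auto intro: continuous_periodic_add f g summable_add)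
qed

lemma uniform_variation_mult:
  assumes "uniform_variation f" "uniform_variation g"
  shows "uniform_variation (\<lambda>n x. f n x * g n x)"
proof -
  obtain K s where f: "\<And>n. continuous_periodic (f n)" "\<And>n x. cmod (f n x) \<le> K" "K \<ge> 0"
    "summable s" "\<And>n x. cmod (f (Suc n) x - f n x) \<le> s n" "\<And>n. s n \<ge> 0"
    using uniform_variationE[OF assms(1)] by metis
  obtain L t where g: "\<And>n. continuous_periodic (g n)" "\<And>n x. cmod (g n x) \<le> L" "L \<ge> 0"
    "summable t" "\<And>n x. cmod (g (Suc n) x - g n x) \<le> t n" "\<And>n. t n \<ge> 0"
    using uniform_variationE[OF assms(2)] by metis
  show ?thesis
  proof (rule uniform_variationI)
    show "cmod (f n x * g n x) \<le> K * L" for n x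
      by (auto simp: norm_mult intro!: mult_mono f g)
    show "cmod (f (Suc n) x * g (Suc n) x - (f n x * g n x)) \<le> s n * L + K * t n" for n x
    proof -
      have "f (Suc n) x * g (Suc n) x - (f n x * g n x) =
        (f (Suc n) x - f n x) * g (Suc n) x + f n x * (g (Suc n) x - g n x)"
        by (simp add: algebra_simps)
      also have "cmod \<dots> \<le> s n * L + K * t n"
        by (intro norm_triangle_mono) (auto simp: norm_mult intro!: mult_mono f g)
      finally show ?thesis .
    qed
    show "summable (\<lambda>n. s n * L + K * t n)"
      by (intro summable_add summable_mult summable_mult2 f g)
  qed (auto intro: continuous_periodic_mult f g)
qed

lemma uniform_variation_cnj:
  assumes "uniform_variation f"
  shows "uniform_variation (\<lambda>n x. cnj (f n x))"
proof -
  obtain K s where f: "\<And>n. continuous_periodic (f n)" "\<And>n x. cmod (f n x) \<le> K" "K \<ge> 0"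
    "summable s" "\<And>n x. cmod (f (Suc n) x - f n x) \<le> s n" "\<And>n. s n \<ge> 0"
    using uniform_variationE[OF assms(1)] by metis
  show ?thesis
    by (rule uniform_variationI[where K = K and s = s])
      (auto intro: continuous_periodic_cnj f simp flip: complex_cnj_diff)
qed

lemma uniform_variation_Suc:
  assumes "uniform_variation f"
  shows "uniform_variation (\<lambda>n. f (Suc n))"
proof -
  obtain K s where f: "\<And>n. continuous_periodic (f n)" "\<And>n x. cmod (f n x) \<le> K" "K \<ge> 0"
    "summable s" "\<And>n x. cmod (f (Suc n) x - f n x) \<le> s n" "\<And>n. s n \<ge> 0"
    using uniform_variationE[OF assms(1)] by metis
  show ?thesis
    by (rule uniform_variationI[where K = K and s = "\<lambda>n. s (Suc n)"])
      (auto intro: f simp: summable_Suc_iff)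
qed

lemma uniform_variation_inverse:
  assumes "uniform_variation f" "\<delta> > 0" "\<And>n x. cmod (f n x) \<ge> \<delta>"
  shows "uniform_variation (\<lambda>n x. inverse (f n x))"
proof -
  obtain K s where f: "\<And>n. continuous_periodic (f n)" "\<And>n x. cmod (f n x) \<le> K" "K \<ge> 0"
    "summable s" "\<And>n x. cmod (f (Suc n) x - f n x) \<le> s n" "\<And>n. s n \<ge> 0"
    using uniform_variationE[OF assms(1)] by metis
  have nz: "f n x \<noteq> 0" for n x using assms(2) assms(3)[of n x] by auto
  have inv: "cmod (inverse (f n x)) \<le> inverse \<delta>" for n x
    using assms(2) assms(3)[of n x] by (simp add: norm_inverse le_imp_inverse_le)
  show ?thesis
  proof (rule uniform_variationI[where K = "inverse \<delta>" and s = "\<lambda>n. inverse \<delta> * s n * inverse \<delta>"])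
    show "cmod (inverse (f (Suc n) x) - inverse (f n x)) \<le> inverse \<delta> * s n * inverse \<delta>" for n x
    proof -
      have "inverse (f (Suc n) x) - inverse (f n x) =
         - (inverse (f (Suc n) x) * (f (Suc n) x - f n x) * inverse (f n x))"
        using nz by (simp add: inverse_diff_inverse)
      also have "cmod \<dots> \<le> inverse \<delta> * s n * inverse \<delta>"
        using assms(2) unfolding norm_minus_cancel norm_mult
        by (intro mult_mono inv f) (auto simp: f)
      finally show ?thesis .
    qed
    show "summable (\<lambda>n. inverse \<delta> * s n * inverse \<delta>)"
      by (intro summable_mult summable_mult2 f)
  qed (intro continuous_periodic_inverse f nz inv)+
qed

lemma uniform_variation_uniformly_cauchy:
  assumes "uniform_variation f" "d > 0"
  obtains N where "\<And>m n x. m \<ge> N \<Longrightarrow> n \<ge> N \<Longrightarrow> cmod (f m x - f n x) \<le> d"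
proof -
  obtain K s where f: "\<And>n. continuous_periodic (f n)" "\<And>n x. cmod (f n x) \<le> K" "K \<ge> 0"
    "summable s" "\<And>n x. cmod (f (Suc n) x - f n x) \<le> s n" "\<And>n. s n \<ge> 0"
    using uniform_variationE[OF assms(1)] by metis
  have step: "cmod (f m x - f n x) \<le> sum s {n..<m}" if "n \<le> m" for m n x
    using that
  proof (induction m rule: dec_induct)
    case (step m)
    have "cmod (f (Suc m) x - f n x) \<le> cmod (f (Suc m) x - f m x) + cmod (f m x - f n x)"
      by (metis diff_add_cancel add_diff_eq norm_triangle_ineq)
    also have "\<dots> \<le> sum s {n..<Suc m}" using step f(5)[of m x] by simp
    finally show ?case .
  qed simp
  obtain N where N: "\<And>m n. m \<ge> N \<Longrightarrow> norm (sum s {m..<n}) < d"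
    using f(4) assms(2) unfolding summable_Cauchy by blast
  have "cmod (f m x - f n x) \<le> d" if "m \<ge> N" "n \<ge> N" for m n x
  proof (cases "n \<le> m")
    case True
    then show ?thesis using step[OF True, of x] N[of n m] that by simp
  next
    case False
    then have "cmod (f n x - f m x) \<le> d" using step[of m n x] N[of m n] that by simp
    then show ?thesis by (simp add: norm_minus_commute)
  qed
  then show ?thesis using that by blast
qed

lemma uniform_variation_imp_L2_cauchy:
  assumes "uniform_variation f"
  shows "L2_cauchy f"
  unfolding L2_cauchy_def
proof (intro conjI allI impI)
  show f: "continuous_periodic (f n)" for n
    using assms by (simp add: uniform_variation_def)
  fix e :: real assume e: "e > 0"
  \<comment> \<open>Chosen so that \<open>2 * pi * d\<^sup>2\<close> is
    \<open>e / 2\<close>.\<close>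
  define d where "d = sqrt (e / (4 * pi))"
  have d: "d > 0" "2 * pi * d\<^sup>2 < e" using e by (auto simp: d_def)
  obtain N where N: "\<And>m n x. m \<ge> N \<Longrightarrow> n \<ge> N \<Longrightarrow> cmod (f m x - f n x) \<le> d"
    using uniform_variation_uniformly_cauchy[OF assms d(1)] by blast
  show "\<exists>N. \<forall>m\<ge>N. \<forall>n\<ge>N. energy (\<lambda>x. f m x - f n x) < e"
    using energy_bound[OF continuous_periodic_diff[OF f f] N] d(2)
    by (meson le_less_trans)
qed

section \<open>Mean square Cauchy sequences\<close>

lemma L2_cauchy_add:
  assumes "L2_cauchy f" "L2_cauchy g"
  shows "L2_cauchy (\<lambda>n x. f n x + g n x)"
  unfolding L2_cauchy_def
proof (intro conjI allI impI)
  have cp: "continuous_periodic (f n)" "continuous_periodic (g n)" for n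
    using assms by (auto simp: L2_cauchy_def)
  show "continuous_periodic (\<lambda>x. f n x + g n x)" for n
    by (intro continuous_periodic_add cp)
  fix e :: real assume "e > 0"
  then have e4: "e / 4 > 0" by simp
  obtain N1 where N1: "\<forall>m\<ge>N1. \<forall>n\<ge>N1. energy (\<lambda>x. f m x - f n x) < e / 4"
    using assms(1) e4 unfolding L2_cauchy_def by blast
  obtain N2 where N2: "\<forall>m\<ge>N2. \<forall>n\<ge>N2. energy (\<lambda>x. g m x - g n x) < e / 4"
    using assms(2) e4 unfolding L2_cauchy_def by blast
  show "\<exists>N. \<forall>m\<ge>N. \<forall>n\<ge>N. energy (\<lambda>x. f m x + g m x - (f n x + g n x)) < e"
  proof (intro exI allI impI)
    fix m n assume mn: "max N1 N2 \<le> m" "max N1 N2 \<le> n"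
    have "energy (\<lambda>x. f m x + g m x - (f n x + g n x)) =
       energy (\<lambda>x. (f m x - f n x) + (g m x - g n x))"
      by (simp add: algebra_simps)
    also have "\<dots> \<le> 2 * energy (\<lambda>x. f m x - f n x) + 2 * energy (\<lambda>x. g m x - g n x)"
      by (intro energy_add continuous_periodic_diff cp)
    also have "\<dots> < e" using N1[rule_format, of m n] N2[rule_format, of m n] mn by simp
    finally show "energy (\<lambda>x. f m x + g m x - (f n x + g n x)) < e" .
  qed
qed

text \<open>Controls the cross term \<open>f n x * (g m x - g n x)\<close> in
  \<open>L2_cauchy_mult\<close>.\<close>

lemma L2_cauchy_energy_bounded:
  assumes "L2_cauchy f"
  obtains B where "B \<ge> 0" "\<And>n. energy (f n) \<le> B"
proof -
  have cp: "continuous_periodic (f n)" for n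
    using assms by (auto simp: L2_cauchy_def)
  have "(1::real) > 0" by simp
  then obtain N where N: "\<forall>m\<ge>N. \<forall>n\<ge>N. energy (\<lambda>x. f m x - f n x) < 1"
    using assms unfolding L2_cauchy_def by blast
  define B where "B = 2 + 2 * energy (f N) + sum (\<lambda>n. energy (f n)) {..<N}"
  have "energy (f n) \<le> B" for n
  proof (cases "n < N")
    case True
    then have "energy (f n) \<le> sum (\<lambda>n. energy (f n)) {..<N}"
      by (intro member_le_sum) (auto simp: energy_nonneg)
    then show ?thesis using energy_nonneg[of "f N"] by (simp add: B_def)
  next
    case False
    have "energy (\<lambda>x. (f n x - f N x) + f N x) \<le> 2 * energy (\<lambda>x. f n x - f N x) + 2 * energy (f N)"
      by (intro energy_add continuous_periodic_diff cp)
    also have "\<dots> \<le> 2 + 2 * energy (f N)" using N[rule_format, of n N] False by simp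
    also have "\<dots> \<le> B" by (simp add: B_def sum_nonneg energy_nonneg)
    finally show ?thesis by simp
  qed
  moreover have "B \<ge> 0" using calculation[of 0] energy_nonneg[of "f 0"] by linarith
  ultimately show ?thesis using that by blast
qed

text \<open>Only one factor is taken in mean square: after splitting the difference into
  \<open>(f m x - f n x) * g m x\<close> and \<open>f n x * (g m x - g n x)\<close>, the factor with
  \<open>g\<close> is measured in the sup norm both times.\<close>

lemma L2_cauchy_mult:
  assumes "L2_cauchy f" "uniform_variation g"
  shows "L2_cauchy (\<lambda>n x. f n x * g n x)"
  unfolding L2_cauchy_def
proof (intro conjI allI impI)
  obtain L where g: "\<And>n. continuous_periodic (g n)" "\<And>n x. cmod (g n x) \<le> L"
    using uniform_variationE[OF assms(2)] by metis
  have f: "continuous_periodic (f n)" for n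
    using assms by (auto simp: L2_cauchy_def)
  show "continuous_periodic (\<lambda>x. f n x * g n x)" for n
    by (intro continuous_periodic_mult f g)
  obtain B where B: "B \<ge> 0" "\<And>n. energy (f n) \<le> B"
    using L2_cauchy_energy_bounded[OF assms(1)] by blast
  fix e :: real assume e: "e > 0"
  \<comment> \<open>\<open>d\<close> and \<open>e'\<close> make each of the two doubled terms at
    most \<open>e / 4\<close>; adding 1 to \<open>B\<close> and to \<open>L\<^sup>2\<close> keeps
    the denominators positive.\<close>
  define d where "d = sqrt (e / (8 * (B + 1)))"
  have d: "d > 0" "d\<^sup>2 * B \<le> e / 8"
    using e B(1) by (auto simp: d_def field_simps)
  define e' where "e' = e / (8 * (L\<^sup>2 + 1))"
  have p: "L\<^sup>2 + 1 > 0" by (simp add: add_nonneg_pos)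
  have e': "e' > 0" "L\<^sup>2 * e' \<le> e / 8"
    using e p by (auto simp: e'_def field_simps)
  obtain N1 where N1: "\<forall>m\<ge>N1. \<forall>n\<ge>N1. energy (\<lambda>x. f m x - f n x) < e'"
    using assms(1) e'(1) unfolding L2_cauchy_def by blast
  obtain N2 where N2: "\<And>m n x. m \<ge> N2 \<Longrightarrow> n \<ge> N2 \<Longrightarrow> cmod (g m x - g n x) \<le> d"
    using uniform_variation_uniformly_cauchy[OF assms(2) d(1)] by blast
  show "\<exists>N. \<forall>m\<ge>N. \<forall>n\<ge>N. energy (\<lambda>x. f m x * g m x - f n x * g n x) < e"
  proof (intro exI allI impI)
    fix m n assume mn: "max N1 N2 \<le> m" "max N1 N2 \<le> n"
    have "energy (\<lambda>x. f m x * g m x - f n x * g n x) =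
        energy (\<lambda>x. (f m x - f n x) * g m x + f n x * (g m x - g n x))"
      by (simp add: algebra_simps)
    also have "\<dots> \<le> 2 * energy (\<lambda>x. (f m x - f n x) * g m x) + 2 * energy (\<lambda>x. f n x * (g m x - g n x))"
      by (intro energy_add continuous_periodic_mult continuous_periodic_diff f g)
    also have "\<dots> \<le> 2 * (L\<^sup>2 * energy (\<lambda>x. f m x - f n x)) + 2 * (d\<^sup>2 * energy (f n))"
      using N2 mn
      by (intro add_mono mult_left_mono energy_mult_le continuous_periodic_diff f g) auto
    also have "\<dots> \<le> 2 * (L\<^sup>2 * e') + 2 * (d\<^sup>2 * B)"
      using N1[rule_format, of m n] mn B(2)[of n]
      by (intro add_mono mult_left_mono) auto
    also have "\<dots> < e" using d(2) e'(2) e by linarith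
    finally show "energy (\<lambda>x. f m x * g m x - f n x * g n x) < e" .
  qed
qed

section \<open>Sums, products and reciprocals in the derivative classes\<close>

lemma deriv_class_SucI:
  assumes "uniform_variation f" "\<And>n x. (f n has_vector_derivative g n x) (at x)" "deriv_class P k g"
  shows "deriv_class P (Suc k) f"
  using assms by auto

lemma deriv_class_SucE:
  assumes "deriv_class P (Suc k) f"
  obtains g where "uniform_variation f" "\<And>n x. (f n has_vector_derivative g n x) (at x)"
    "deriv_class P k g"
  using assms by auto

lemma deriv_class_mono:
  assumes "\<And>f. P f \<Longrightarrow> Q f"
  shows "deriv_class P k f \<Longrightarrow> deriv_class Q k f"
proof (induction k arbitrary: f)
  case (Suc k)
  show ?case
    using deriv_class_SucE[OF Suc.prems] Suc.IH deriv_class_SucI by metis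
qed (simp add: assms)

lemma var_class_imp_L2_class: "var_class k f \<Longrightarrow> L2_class k f"
  by (rule deriv_class_mono[where P = uniform_variation]) (rule uniform_variation_imp_L2_cauchy)

lemma deriv_class_Suc_imp_var_class: "deriv_class P (Suc k) f \<Longrightarrow> var_class k f"
proof (induction k arbitrary: f)
  case (Suc k)
  show ?case
    using deriv_class_SucE[OF Suc.prems] Suc.IH deriv_class_SucI by metis
qed simp

lemmas L2_class_Suc_imp_var_class = deriv_class_Suc_imp_var_class[where P = L2_cauchy]
lemmas var_class_Suc = deriv_class_Suc_imp_var_class[where P = uniform_variation]

lemma deriv_class_add:
  assumes P: "\<And>f g. P f \<Longrightarrow> P g \<Longrightarrow> P (\<lambda>n x. f n x + g n x)"
  shows "deriv_class P k f \<Longrightarrow> deriv_class P k g \<Longrightarrow> deriv_class P k (\<lambda>n x. f n x + g n x)"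
proof (induction k arbitrary: f g)
  case 0
  then show ?case using P by simp
next
  case (Suc k)
  obtain f' where f: "uniform_variation f" "\<And>n x. (f n has_vector_derivative f' n x) (at x)" "deriv_class P k f'"
    using deriv_class_SucE[OF Suc.prems(1)] by blast
  obtain g' where g: "uniform_variation g" "\<And>n x. (g n has_vector_derivative g' n x) (at x)" "deriv_class P k g'"
    using deriv_class_SucE[OF Suc.prems(2)] by blast
  have "((\<lambda>x. f n x + g n x) has_vector_derivative f' n x + g' n x) (at x)" for n x
    by (intro has_vector_derivative_add f g)
  then show ?case
    by (rule deriv_class_SucI[OF uniform_variation_add[OF f(1) g(1)] _ Suc.IH[OF f(3) g(3)]])
qed

lemma var_class_add: "var_class k f \<Longrightarrow> var_class k g \<Longrightarrow> var_class k (\<lambda>n x. f n x + g n x)"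
  by (rule deriv_class_add[where P = uniform_variation])
    (assumption | erule (1) uniform_variation_add)+

lemma L2_class_add: "L2_class k f \<Longrightarrow> L2_class k g \<Longrightarrow> L2_class k (\<lambda>n x. f n x + g n x)"
  by (rule deriv_class_add[where P = L2_cauchy])
    (assumption | erule (1) L2_cauchy_add)+

text \<open>In f g' + f' g the undifferentiated \<open>f\<close> is used one level lower, which
  \<open>lower\<close> permits. For \<open>L2_cauchy\<close> that holds because uniform variation
  implies the mean square Cauchy property.\<close>

lemma deriv_class_mult:
  assumes add: "\<And>f g. P f \<Longrightarrow> P g \<Longrightarrow> P (\<lambda>n x. f n x + g n x)"
    and mult: "\<And>f g. P f \<Longrightarrow> uniform_variation g \<Longrightarrow> P (\<lambda>n x. f n x * g n x)"
    and lower: "\<And>k f. deriv_class P (Suc k) f \<Longrightarrow> deriv_class P k f"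
  shows "deriv_class P k f \<Longrightarrow> var_class k g \<Longrightarrow> deriv_class P k (\<lambda>n x. f n x * g n x)"
proof (induction k arbitrary: f g)
  case 0
  then show ?case using mult by simp
next
  case (Suc k)
  obtain f' where f: "uniform_variation f" "\<And>n x. (f n has_vector_derivative f' n x) (at x)" "deriv_class P k f'"
    using deriv_class_SucE[OF Suc.prems(1)] by blast
  obtain g' where g: "uniform_variation g" "\<And>n x. (g n has_vector_derivative g' n x) (at x)" "var_class k g'"
    using deriv_class_SucE[OF Suc.prems(2)] by blast
  have "((\<lambda>x. f n x * g n x) has_vector_derivative f n x * g' n x + f' n x * g n x) (at x)" for n x
    by (intro has_vector_derivative_mult f g)
  moreover have "deriv_class P k (\<lambda>n x. f n x * g' n x + f' n x * g n x)"
    using deriv_class_add[where P = P, OF add Suc.IH[OF lower[OF Suc.prems(1)] g(3)]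
        Suc.IH[OF f(3) var_class_Suc[OF Suc.prems(2)]]] .
  ultimately show ?case
    by (rule deriv_class_SucI[OF uniform_variation_mult[OF f(1) g(1)]])
qed

lemma L2_class_Suc: "L2_class (Suc k) f \<Longrightarrow> L2_class k f"
  by (erule var_class_imp_L2_class[OF L2_class_Suc_imp_var_class])

lemma var_class_mult: "var_class k f \<Longrightarrow> var_class k g \<Longrightarrow> var_class k (\<lambda>n x. f n x * g n x)"
  by (rule deriv_class_mult[where P = uniform_variation])
    (assumption | erule (1) uniform_variation_add | erule (1) uniform_variation_mult | erule var_class_Suc)+

lemma L2_var_class_mult: "L2_class k f \<Longrightarrow> var_class k g \<Longrightarrow> L2_class k (\<lambda>n x. f n x * g n x)"
  by (rule deriv_class_mult[where P = L2_cauchy])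
    (assumption | erule (1) L2_cauchy_add | erule (1) L2_cauchy_mult | erule L2_class_Suc)+

text \<open>The discrete form of H^k being an algebra for k \<ge> 1. The level is a successor so
  that after one differentiation each term has one factor in \<open>L2_class k\<close> and the other
  in \<open>var_class k\<close>; at level 0 two mean square factors would be multiplied.\<close>

lemma L2_class_mult:
  assumes "L2_class (Suc k) f" "L2_class (Suc k) g"
  shows "L2_class (Suc k) (\<lambda>n x. f n x * g n x)"
proof -
  obtain f' where f: "uniform_variation f" "\<And>n x. (f n has_vector_derivative f' n x) (at x)" "L2_class k f'"
    using deriv_class_SucE[OF assms(1)] by blast
  obtain g' where g: "uniform_variation g" "\<And>n x. (g n has_vector_derivative g' n x) (at x)" "L2_class k g'"
    using deriv_class_SucE[OF assms(2)] by blast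
  have "((\<lambda>x. f n x * g n x) has_vector_derivative g' n x * f n x + f' n x * g n x) (at x)" for n x
    using has_vector_derivative_mult[OF f(2)[of n x] g(2)[of n x]] by (simp only: mult.commute)
  moreover have "L2_class k (\<lambda>n x. g' n x * f n x + f' n x * g n x)"
    by (intro L2_class_add[OF L2_var_class_mult[OF g(3) L2_class_Suc_imp_var_class[OF assms(1)]]
        L2_var_class_mult[OF f(3) L2_class_Suc_imp_var_class[OF assms(2)]]])
  ultimately show ?thesis
    by (rule deriv_class_SucI[OF uniform_variation_mult[OF f(1) g(1)]])
qed

lemma deriv_class_cnj:
  assumes P: "\<And>f. P f \<Longrightarrow> P (\<lambda>n x. cnj (f n x))"
  shows "deriv_class P k f \<Longrightarrow> deriv_class P k (\<lambda>n x. cnj (f n x))"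
proof (induction k arbitrary: f)
  case 0
  then show ?case using P by simp
next
  case (Suc k)
  obtain f' where f: "uniform_variation f" "\<And>n x. (f n has_vector_derivative f' n x) (at x)" "deriv_class P k f'"
    using deriv_class_SucE[OF Suc.prems(1)] by blast
  have "((\<lambda>x. cnj (f n x)) has_vector_derivative cnj (f' n x)) (at x)" for n x
    by (intro has_vector_derivative_cnj f)
  then show ?case
    by (rule deriv_class_SucI[OF uniform_variation_cnj[OF f(1)] _ Suc.IH[OF f(3)]])
qed

lemma L2_cauchy_cnj:
  assumes "L2_cauchy f"
  shows "L2_cauchy (\<lambda>n x. cnj (f n x))"
proof -
  have "energy (\<lambda>x. cnj (f m x) - cnj (f n x)) = energy (\<lambda>x. f m x - f n x)" for m n
    unfolding energy_def by (metis complex_cnj_diff complex_mod_cnj)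
  then show ?thesis
    using assms continuous_periodic_cnj by (simp add: L2_cauchy_def)
qed

lemma var_class_cnj: "var_class k f \<Longrightarrow> var_class k (\<lambda>n x. cnj (f n x))"
  by (rule deriv_class_cnj[where P = uniform_variation])
    (assumption | erule uniform_variation_cnj)+

lemma L2_class_cnj: "L2_class k f \<Longrightarrow> L2_class k (\<lambda>n x. cnj (f n x))"
  by (rule deriv_class_cnj[where P = L2_cauchy])
    (assumption | erule L2_cauchy_cnj)+

lemma var_class_shift: "var_class k f \<Longrightarrow> var_class k (\<lambda>n. f (Suc n))"
proof (induction k arbitrary: f)
  case 0
  then show ?case by (simp add: uniform_variation_Suc)
next
  case (Suc k)
  obtain f' where f: "uniform_variation f" "\<And>n x. (f n has_vector_derivative f' n x) (at x)" "var_class k f'"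
    using deriv_class_SucE[OF Suc.prems(1)] by blast
  show ?case
    by (rule deriv_class_SucI[OF uniform_variation_Suc[OF f(1)] f(2) Suc.IH[OF f(3)]])
qed

lemma uniform_variation_const:
  "summable (\<lambda>n. cmod (c (Suc n) - c n)) \<Longrightarrow> uniform_variation (\<lambda>n x. c n)"
proof -
  assume c: "summable (\<lambda>n. cmod (c (Suc n) - c n))"
  have "uniform_variation (\<lambda>n x. (c n - c 0))"
    using c by (intro uniform_variation_bounded_increments) (auto intro: continuous_periodic_const)
  moreover have "uniform_variation (\<lambda>n x. c 0)"
    by (rule uniform_variationI[where s = "\<lambda>n. 0"]) (auto intro: continuous_periodic_const)
  ultimately show ?thesis using uniform_variation_add[of "\<lambda>n x. c n - c 0" "\<lambda>n x. c 0"] by simp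
qed

lemma var_class_const:
  "summable (\<lambda>n. cmod (c (Suc n) - c n)) \<Longrightarrow> var_class k (\<lambda>n x. c n)"
proof (induction k arbitrary: c)
  case 0
  then show ?case by (simp add: uniform_variation_const)
next
  case (Suc k)
  have "var_class k (\<lambda>n x. 0)" using Suc.IH[of "\<lambda>n. 0"] by simp
  then show ?case
    by (rule deriv_class_SucI[OF uniform_variation_const[OF Suc.prems] has_vector_derivative_const])
qed

text \<open>The derivative is spelled out as a product, with the sign as a constant factor, so that
  closure under products applies to it directly.\<close>

lemma has_vector_derivative_inverse_complex:
  fixes f :: "real \<Rightarrow> complex"
  assumes "(f has_vector_derivative f') (at x)" "f x \<noteq> 0"
  shows "((\<lambda>x. inverse (f x)) has_vector_derivative (- 1) * f' * (inverse (f x) * inverse (f x))) (at x)"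
  using Deriv.has_derivative_inverse[OF assms(2) assms(1)[unfolded has_vector_derivative_def]]
  unfolding has_vector_derivative_def
  by (rule has_derivative_eq_rhs) (simp add: fun_eq_iff scaleR_conv_of_real)

text \<open>The derivative -f'/f^2 contains the reciprocal undifferentiated, so the induction
  hypothesis one level lower closes the step.\<close>

lemma var_class_inverse:
  assumes "\<delta> > 0" "\<And>n x. cmod (f n x) \<ge> \<delta>"
  shows "var_class k f \<Longrightarrow> var_class k (\<lambda>n x. inverse (f n x))"
proof (induction k)
  case 0
  then show ?case using assms by (simp add: uniform_variation_inverse)
next
  case (Suc k)
  obtain f' where f: "uniform_variation f" "\<And>n x. (f n has_vector_derivative f' n x) (at x)" "var_class k f'"
    using deriv_class_SucE[OF Suc.prems(1)] by blast
  have nz: "f n x \<noteq> 0" for n x using assms(1) assms(2)[of n x] by auto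
  have inv: "var_class k (\<lambda>n x. inverse (f n x))"
    by (rule Suc.IH[OF var_class_Suc[OF Suc.prems(1)]])
  have "var_class k (\<lambda>n x. - 1)"
    by (rule var_class_const) simp
  then have "var_class k (\<lambda>n x. (- 1) * f' n x * (inverse (f n x) * inverse (f n x)))"
    by (rule var_class_mult[OF var_class_mult[OF _ f(3)] var_class_mult[OF inv inv]])
  then show ?case
    by (rule deriv_class_SucI[OF uniform_variation_inverse[OF f(1) assms]
          has_vector_derivative_inverse_complex[OF f(2) nz]])
qed

lemma L2_class_inverse:
  assumes "\<delta> > 0" "\<And>n x. cmod (f n x) \<ge> \<delta>" "L2_class (Suc k) f"
  shows "L2_class (Suc k) (\<lambda>n x. inverse (f n x))"
proof -
  obtain f' where f: "uniform_variation f" "\<And>n x. (f n has_vector_derivative f' n x) (at x)" "L2_class k f'"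
    using deriv_class_SucE[OF assms(3)] by blast
  have nz: "f n x \<noteq> 0" for n x using assms(1) assms(2)[of n x] by auto
  have inv: "var_class k (\<lambda>n x. inverse (f n x))"
    by (rule var_class_inverse[OF assms(1,2) L2_class_Suc_imp_var_class[OF assms(3)]])
  have "var_class k (\<lambda>n x. - 1)"
    by (rule var_class_const) simp
  then have "L2_class k (\<lambda>n x. f' n x * (- 1) * (inverse (f n x) * inverse (f n x)))"
    by (rule L2_var_class_mult[OF L2_var_class_mult[OF f(3)] var_class_mult[OF inv inv]])
  then have "L2_class k (\<lambda>n x. (- 1) * f' n x * (inverse (f n x) * inverse (f n x)))"
    by (simp only: mult.commute[of _ "- 1"])
  then show ?thesis
    by (rule deriv_class_SucI[OF uniform_variation_inverse[OF f(1) assms(1,2)]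
          has_vector_derivative_inverse_complex[OF f(2) nz]])
qed

section \<open>Oscillating sums\<close>

lemma has_vector_derivative_cis_mult:
  "((\<lambda>x. cis (real_of_int w * x)) has_vector_derivative \<i> * of_int w * cis (real_of_int w * x)) (at x within A)"
  unfolding has_vector_derivative_def
  by (auto intro!: derivative_eq_intros simp: fun_eq_iff scaleR_conv_of_real)

lemma integral_cis_circle:
  assumes "w \<noteq> 0"
  shows "integral\<^sup>L circle_measure (\<lambda>x. cis (real_of_int w * x)) = 0"
proof -
  let ?F = "\<lambda>x. cis (real_of_int w * x) / (\<i> * of_int w)"
  have "((\<lambda>x. cis (real_of_int w * x)) has_integral (?F pi - ?F (- pi))) {-pi..pi}"
  proof (rule fundamental_theorem_of_calculus)
    show "(?F has_vector_derivative cis (real_of_int w * x)) (at x within {-pi..pi})" for x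
      using has_vector_derivative_divide[OF has_vector_derivative_cis_mult[of w x "{-pi..pi}"],
          of "\<i> * of_int w"] assms by simp
  qed simp
  moreover have "?F pi = ?F (- pi)"
    using cis_periodic_int[of w "- pi"] by simp
  ultimately have "integral {-pi..pi} (\<lambda>x. cis (real_of_int w * x)) = 0"
    by (simp add: integral_unique)
  moreover have "integrable circle_measure (\<lambda>x. cis (real_of_int w * x))"
    by (intro integrable_circle continuous_intros)
  ultimately show ?thesis by (simp add: lebesgue_integral_eq_integral)
qed

text \<open>Parseval for a trigonometric polynomial: after expanding the square, distinct
  frequencies leave only the diagonal.\<close>

lemma energy_trigonometric_sum:
  assumes "inj_on w F" "finite F"
  shows "energy (\<lambda>x. \<Sum>n\<in>F. s n * cis (real_of_int (w n) * x)) = 2 * pi * (\<Sum>n\<in>F. (cmod (s n))\<^sup>2)"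
proof -
  have eq: "complex_of_real ((cmod (\<Sum>n\<in>F. s n * cis (real_of_int (w n) * x)))\<^sup>2) =
      (\<Sum>n\<in>F. \<Sum>m\<in>F. s n * cnj (s m) * cis (real_of_int (w n - w m) * x))" for x
  proof -
    have "complex_of_real ((cmod (\<Sum>n\<in>F. s n * cis (real_of_int (w n) * x)))\<^sup>2) =
      (\<Sum>n\<in>F. s n * cis (real_of_int (w n) * x)) * (\<Sum>m\<in>F. cnj (s m) * cis (- (real_of_int (w m) * x)))"
      by (simp only: complex_norm_square cnj_sum complex_cnj_mult cis_cnj)
    also have "\<dots> = (\<Sum>n\<in>F. \<Sum>m\<in>F. s n * cnj (s m) * cis (real_of_int (w n - w m) * x))"
      unfolding sum_product
    proof (intro sum.cong refl)
      fix n m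
      have "cis (real_of_int (w n) * x) * cis (- (real_of_int (w m) * x)) = cis (real_of_int (w n - w m) * x)"
        by (simp add: cis_mult left_diff_distrib)
      then show "s n * cis (real_of_int (w n) * x) * (cnj (s m) * cis (- (real_of_int (w m) * x))) =
          s n * cnj (s m) * cis (real_of_int (w n - w m) * x)"
        by (simp add: ac_simps)
    qed
    finally show ?thesis .
  qed
  have int: "integrable circle_measure (\<lambda>x. s n * cnj (s m) * cis (real_of_int (w n - w m) * x))" for n m
    by (intro integrable_circle continuous_intros)
  have val: "integral\<^sup>L circle_measure (\<lambda>x. s n * cnj (s m) * cis (real_of_int (w n - w m) * x)) =
      (if n = m then complex_of_real (2 * pi * (cmod (s n))\<^sup>2) else 0)" if "n \<in> F" "m \<in> F" for n m
  proof (cases "n = m")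
    case True
    have "integral\<^sup>L circle_measure (\<lambda>x. complex_of_real ((cmod (s n))\<^sup>2)) =
        complex_of_real (2 * pi * (cmod (s n))\<^sup>2)"
      using integral_const_circle by (simp only: integral_complex_of_real)
    moreover have "s n * cnj (s m) * cis (real_of_int (w n - w m) * x) = complex_of_real ((cmod (s n))\<^sup>2)" for x
      using True by (simp add: complex_norm_square[symmetric] del: of_real_power)
    ultimately show ?thesis by (simp only: True if_True refl)
  next
    case False
    then have "w n - w m \<noteq> 0" using assms(1) that by (auto simp: inj_on_def)
    from integral_cis_circle[OF this] show ?thesis using False by (simp del: of_int_diff)
  qed
  have "complex_of_real (energy (\<lambda>x. \<Sum>n\<in>F. s n * cis (real_of_int (w n) * x))) =
      integral\<^sup>L circle_measure (\<lambda>x. \<Sum>n\<in>F. \<Sum>m\<in>F. s n * cnj (s m) * cis (real_of_int (w n - w m) * x))"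
    unfolding energy_def by (simp only: integral_complex_of_real[symmetric] eq)
  also have "\<dots> = (\<Sum>n\<in>F. \<Sum>m\<in>F. if n = m then complex_of_real (2 * pi * (cmod (s n))\<^sup>2) else 0)"
    by (simp only: Bochner_Integration.integral_sum[OF Bochner_Integration.integrable_sum[OF int]]
        Bochner_Integration.integral_sum[OF int] val cong: sum.cong)
  also have "\<dots> = complex_of_real (2 * pi * (\<Sum>n\<in>F. (cmod (s n))\<^sup>2))"
    using assms(2) by (simp add: sum_distrib_left)
  finally show ?thesis using of_real_eq_iff by blast
qed

text \<open>Minkowski's inequality in squared form. Splitting each \<open>t n\<close> into two
  square roots before Cauchy-Schwarz gives a bound that sees the sum of the weights but not the
  number of terms.\<close>

lemma energy_weighted_sum:
  assumes W: "\<And>n. n \<in> F \<Longrightarrow> continuous_periodic (W n)" "\<And>n. n \<in> F \<Longrightarrow> energy (W n) \<le> E"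
    and D: "\<And>n. n \<in> F \<Longrightarrow> continuous_periodic (D n)" "\<And>n x. n \<in> F \<Longrightarrow> cmod (D n x) \<le> t n"
  shows "energy (\<lambda>x. \<Sum>n\<in>F. W n x * D n x) \<le> (sum t F)\<^sup>2 * E"
proof -
  have t: "t n \<ge> 0" if "n \<in> F" for n using D(2)[OF that, of 0] norm_ge_zero order_trans by blast
  have pt: "(cmod (\<Sum>n\<in>F. W n x * D n x))\<^sup>2 \<le> sum t F * (\<Sum>n\<in>F. t n * (cmod (W n x))\<^sup>2)" for x
  proof -
    have "cmod (\<Sum>n\<in>F. W n x * D n x) \<le> (\<Sum>n\<in>F. sqrt (t n) * (sqrt (t n) * cmod (W n x)))"
    proof (rule order_trans[OF norm_sum sum_mono])
      fix n assume n: "n \<in> F"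
      have "cmod (W n x * D n x) \<le> t n * cmod (W n x)"
        using D(2)[OF n, of x] by (simp add: norm_mult mult.commute mult_right_mono)
      also have "\<dots> = sqrt (t n) * (sqrt (t n) * cmod (W n x))"
        using t[OF n] by (simp add: mult.assoc[symmetric])
      finally show "cmod (W n x * D n x) \<le> sqrt (t n) * (sqrt (t n) * cmod (W n x))" .
    qed
    then have "(cmod (\<Sum>n\<in>F. W n x * D n x))\<^sup>2 \<le> (\<Sum>n\<in>F. sqrt (t n) * (sqrt (t n) * cmod (W n x)))\<^sup>2"
      by (rule power_mono) simp
    also have "\<dots> \<le> (\<Sum>n\<in>F. (sqrt (t n))\<^sup>2) * (\<Sum>n\<in>F. (sqrt (t n) * cmod (W n x))\<^sup>2)"
      by (rule Cauchy_Schwarz_ineq_sum)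
    also have "\<dots> = sum t F * (\<Sum>n\<in>F. t n * (cmod (W n x))\<^sup>2)"
      using t by (simp add: power_mult_distrib)
    finally show ?thesis .
  qed
  have iW: "integrable circle_measure (\<lambda>x. t n * (cmod (W n x))\<^sup>2)" if "n \<in> F" for n
    by (intro integrable_mult_right integrable_energy W that)
  have "energy (\<lambda>x. \<Sum>n\<in>F. W n x * D n x) \<le>
      integral\<^sup>L circle_measure (\<lambda>x. sum t F * (\<Sum>n\<in>F. t n * (cmod (W n x))\<^sup>2))"
    unfolding energy_def
  proof (rule integral_mono)
    show "integrable circle_measure (\<lambda>x. sum t F * (\<Sum>n\<in>F. t n * (cmod (W n x))\<^sup>2))"
      by (intro integrable_mult_right Bochner_Integration.integrable_sum iW)
    show "integrable circle_measure (\<lambda>x. (cmod (\<Sum>n\<in>F. W n x * D n x))\<^sup>2)"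
      by (intro integrable_energy continuous_periodic_sum continuous_periodic_mult W D)
  qed (rule pt)
  also have "\<dots> = sum t F * (\<Sum>n\<in>F. t n * energy (W n))"
    unfolding energy_def by (simp add: Bochner_Integration.integral_sum[OF iW])
  also have "\<dots> \<le> sum t F * (\<Sum>n\<in>F. t n * E)"
    by (intro mult_left_mono sum_mono W t sum_nonneg) auto
  finally show ?thesis by (simp add: sum_distrib_right[symmetric] power2_eq_square mult.assoc)
qed

text \<open>With \<open>s\<close> only square summable, the terms cannot be estimated one by one.
  Parseval bounds every block of bare exponentials, and Abel summation carries this bound over to
  the factors \<open>g\<close>, whose increments are summable.\<close>

lemma L2_cauchy_lacunary_sum:
  assumes g: "uniform_variation g" and w: "inj w" and s: "summable (\<lambda>n. (cmod (s n))\<^sup>2)"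
  shows "L2_cauchy (\<lambda>N x. \<Sum>n<N. s n * cis (real_of_int (w n) * x) * g n x)"
  unfolding L2_cauchy_def
proof (intro conjI allI impI)
  obtain K t where g': "\<And>n. continuous_periodic (g n)" "\<And>n x. cmod (g n x) \<le> K" "K \<ge> 0"
    "summable t" "\<And>n x. cmod (g (Suc n) x - g n x) \<le> t n" "\<And>n. t n \<ge> 0"
    using uniform_variationE[OF g] by metis
  let ?e = "\<lambda>n x. s n * cis (real_of_int (w n) * x)"
  let ?T = "\<lambda>N x. \<Sum>n<N. ?e n x * g n x"
  have ce: "continuous_periodic (?e n)" for n
    by (intro continuous_periodic_mult continuous_periodic_const continuous_periodic_cis)
  show cT: "continuous_periodic (?T N)" for N
    by (intro continuous_periodic_sum continuous_periodic_mult[OF ce] g')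
  \<comment> \<open>The factor 4 pi is 2 pi from Parseval times 2 from
    \<open>energy_add\<close>.\<close>
  define C where "C = 4 * pi * (K\<^sup>2 + (suminf t)\<^sup>2)"
  have C: "C \<ge> 0" by (simp add: C_def)
  have main: "energy (\<lambda>x. ?T M x - ?T N x) \<le> C * (\<Sum>n\<in>{N..<M}. (cmod (s n))\<^sup>2)" if "N \<le> M" for M N
  proof -
    let ?W = "\<lambda>n x. \<Sum>m\<in>{N..<n}. ?e m x"
    define E where "E = 2 * pi * (\<Sum>n\<in>{N..<M}. (cmod (s n))\<^sup>2)"
    have W: "energy (?W n) \<le> E" if "n \<le> M" for n
    proof -
      have "energy (?W n) = 2 * pi * (\<Sum>n\<in>{N..<n}. (cmod (s n))\<^sup>2)"
        using w by (intro energy_trigonometric_sum) (auto simp: inj_on_def)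
      also have "\<dots> \<le> E"
        unfolding E_def using that by (intro mult_left_mono sum_mono2) auto
      finally show ?thesis .
    qed
    have cW: "continuous_periodic (?W n)" for n
      by (intro continuous_periodic_sum ce)
    \<comment> \<open>The partial sums start at \<open>N\<close>, so \<open>?W N\<close> vanishes
      and there is no boundary term at the lower end.\<close>
    have abel: "(\<Sum>n\<in>{N..<M}. ?e n x * g n x) =
        ?W M x * g M x + (\<Sum>n\<in>{N..<M}. ?W (Suc n) x * (g n x - g (Suc n) x))" for x
      using that
    proof (induction M rule: dec_induct)
      case (step M)
      then show ?case by (simp add: algebra_simps)
    qed simp
    have "?T M x - ?T N x = (\<Sum>n\<in>{N..<M}. ?e n x * g n x)" for x
      using sum_diff_nat_ivl[of 0 N M "\<lambda>n. ?e n x * g n x"] that by (simp add: atLeast0LessThan)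
    then have "energy (\<lambda>x. ?T M x - ?T N x) =
        energy (\<lambda>x. ?W M x * g M x + (\<Sum>n\<in>{N..<M}. ?W (Suc n) x * (g n x - g (Suc n) x)))"
      using abel by presburger
    also have "\<dots> \<le> 2 * energy (\<lambda>x. ?W M x * g M x) +
        2 * energy (\<lambda>x. \<Sum>n\<in>{N..<M}. ?W (Suc n) x * (g n x - g (Suc n) x))"
      by (intro energy_add continuous_periodic_sum[of _ "\<lambda>n x. ?W (Suc n) x * (g n x - g (Suc n) x)"]
          continuous_periodic_mult[OF cW] continuous_periodic_diff g')
    also have "\<dots> \<le> 2 * (K\<^sup>2 * E) + 2 * ((sum t {N..<M})\<^sup>2 * E)"
    proof (intro add_mono mult_left_mono)
      have "energy (\<lambda>x. ?W M x * g M x) \<le> K\<^sup>2 * energy (?W M)"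
        by (rule energy_mult_le[OF cW g'(1) g'(2)])
      also have "\<dots> \<le> K\<^sup>2 * E" by (intro mult_left_mono W) auto
      finally show "energy (\<lambda>x. ?W M x * g M x) \<le> K\<^sup>2 * E" .
      show "energy (\<lambda>x. \<Sum>n\<in>{N..<M}. ?W (Suc n) x * (g n x - g (Suc n) x)) \<le> (sum t {N..<M})\<^sup>2 * E"
      proof (rule energy_weighted_sum)
        show "cmod (g n x - g (Suc n) x) \<le> t n" for n x
          using g'(5)[of n x] by (simp add: norm_minus_commute)
        show "energy (?W (Suc n)) \<le> E" if "n \<in> {N..<M}" for n
          using that by (intro W) simp
      qed (intro cW continuous_periodic_diff g')+
    qed auto
    also have "\<dots> \<le> 2 * (K\<^sup>2 * E) + 2 * ((suminf t)\<^sup>2 * E)"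
    proof -
      have "sum t {N..<M} \<le> suminf t"
        using g' by (intro sum_le_suminf) auto
      moreover have "sum t {N..<M} \<ge> 0" using g' by (simp add: sum_nonneg)
      ultimately have "(sum t {N..<M})\<^sup>2 \<le> (suminf t)\<^sup>2" by (intro power_mono)
      moreover have "E \<ge> 0" by (simp add: E_def sum_nonneg)
      ultimately show ?thesis by (simp add: mult_right_mono)
    qed
    also have "\<dots> = C * (\<Sum>n\<in>{N..<M}. (cmod (s n))\<^sup>2)"
      by (simp add: C_def E_def algebra_simps)
    finally show ?thesis .
  qed
  fix e :: real assume e: "e > 0"
  define d where "d = e / (C + 1)"
  have d: "d > 0" "C * d < e"
    using e C by (auto simp: d_def field_simps)
  obtain N0 where N0: "\<And>m n. m \<ge> N0 \<Longrightarrow> norm (\<Sum>i\<in>{m..<n}. (cmod (s i))\<^sup>2) < d"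
    using s d(1) unfolding summable_Cauchy by blast
  have est: "energy (\<lambda>x. ?T M x - ?T N x) < e" if "N \<le> M" "N0 \<le> N" for M N
  proof -
    have "C * (\<Sum>n\<in>{N..<M}. (cmod (s n))\<^sup>2) \<le> C * d"
      using N0[OF that(2), of M] by (intro mult_left_mono C) auto
    then show ?thesis using main[OF that(1)] d(2) by linarith
  qed
  have sym: "energy (\<lambda>x. ?T M x - ?T N x) = energy (\<lambda>x. ?T N x - ?T M x)" for M N
    unfolding energy_def by (simp add: norm_minus_commute)
  show "\<exists>N. \<forall>m\<ge>N. \<forall>n\<ge>N. energy (\<lambda>x. ?T m x - ?T n x) < e"
  proof (intro exI[of _ N0] allI impI)
    fix m n assume mn: "N0 \<le> m" "N0 \<le> n"
    show "energy (\<lambda>x. ?T m x - ?T n x) < e"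
    proof (cases "n \<le> m")
      case True
      then show ?thesis by (rule est) (rule mn)
    next
      case False
      then have "energy (\<lambda>x. ?T n x - ?T m x) < e" by (intro est mn) simp
      then show ?thesis using sym[of m n] by simp
    qed
  qed
qed

section \<open>Derivatives of oscillating sums with weighted coefficients\<close>

lemma has_vector_derivative_oscillating_sum:
  assumes "\<And>n x. (g n has_vector_derivative g' n x) (at x)"
  shows "((\<lambda>x. \<Sum>n<N. s n * cis (real_of_int (w n) * x) * g n x) has_vector_derivative
    (\<Sum>n<N. s n * (\<i> * of_int (w n)) * cis (real_of_int (w n) * x) * g n x) +
    (\<Sum>n<(N::nat). s n * cis (real_of_int (w n) * x) * g' n x)) (at x)"
proof -
  have "((\<lambda>x. s n * cis (real_of_int (w n) * x) * g n x) has_vector_derivative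
      (s n * cis (real_of_int (w n) * x)) * g' n x +
      (s n * (\<i> * of_int (w n) * cis (real_of_int (w n) * x))) * g n x) (at x)" for n
    by (intro has_vector_derivative_mult has_vector_derivative_mult_right
        has_vector_derivative_cis_mult assms)
  then have "((\<lambda>x. \<Sum>n<N. s n * cis (real_of_int (w n) * x) * g n x) has_vector_derivative
      (\<Sum>n<N. (s n * cis (real_of_int (w n) * x)) * g' n x +
      (s n * (\<i> * of_int (w n) * cis (real_of_int (w n) * x))) * g n x)) (at x)"
    by (intro has_vector_derivative_sum)
  then show ?thesis by (simp add: sum.distrib algebra_simps)
qed

lemma uniform_variation_sum:
  assumes "uniform_variation g" "summable (\<lambda>n. cmod (s n))"
  shows "uniform_variation (\<lambda>N x. \<Sum>n<N. s n * cis (real_of_int (w n) * x) * g n x)"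
proof -
  obtain K where g: "\<And>n. continuous_periodic (g n)" "\<And>n x. cmod (g n x) \<le> K"
    using uniform_variationE[OF assms(1)] by metis
  show ?thesis
  proof (rule uniform_variation_bounded_increments)
    show "summable (\<lambda>n. cmod (s n) * K)" by (intro summable_mult2 assms)
    show "cmod ((\<Sum>n<Suc N. s n * cis (real_of_int (w n) * x) * g n x) -
        (\<Sum>n<N. s n * cis (real_of_int (w n) * x) * g n x)) \<le> cmod (s N) * K" for N x
      by (simp add: norm_mult g mult_left_mono)
  qed (simp_all add: continuous_periodic_sum continuous_periodic_mult continuous_periodic_const
      continuous_periodic_cis g)
qed

lemma summable_weight_mono:
  assumes "summable (\<lambda>n. cmod (s n) * c n ^ j)" "\<And>n. c n \<ge> (1::real)" "i \<le> j"
  shows "summable (\<lambda>n. cmod (s n) * c n ^ i)"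
proof (rule summable_comparison_test'[OF assms(1)])
  show "norm (cmod (s n) * c n ^ i) \<le> cmod (s n) * c n ^ j" for n
    using assms(2)[of n] by (simp add: abs_mult mult_left_mono power_increasing assms(3))
qed

text \<open>Writing |s| c^j as |s| c^(j+1) times 1/c and using u v \<le> u^2 + v^2 costs one weight.
  This loss separates the last derivative from the earlier ones.\<close>

lemma summable_weight_of_square:
  assumes "summable (\<lambda>n. (cmod (s n) * c n ^ Suc j)\<^sup>2)" "\<And>n. c n \<ge> (1::real)"
    "summable (\<lambda>n. (inverse (c n))\<^sup>2)"
  shows "summable (\<lambda>n. cmod (s n) * c n ^ j)"
proof (rule summable_comparison_test'[OF summable_add[OF assms(1) assms(3)]])
  show "norm (cmod (s n) * c n ^ j) \<le> (cmod (s n) * c n ^ Suc j)\<^sup>2 + (inverse (c n))\<^sup>2" for n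
  proof -
    let ?u = "cmod (s n) * c n ^ Suc j"
    have cn: "c n > 0" using assms(2)[of n] by linarith
    then have eq: "cmod (s n) * c n ^ j = ?u * inverse (c n)" by simp
    have "0 \<le> ?u * inverse (c n)"
      using cn by (intro mult_nonneg_nonneg) auto
    then have "?u * inverse (c n) \<le> ?u\<^sup>2 + (inverse (c n))\<^sup>2"
      using sum_squares_bound[of ?u "inverse (c n)"] by linarith
    then show ?thesis unfolding eq[symmetric] using cn by simp
  qed
qed

text \<open>A derivative of the exponential moves a factor of modulus at most \<open>c n\<close>
  into the coefficient; a derivative of \<open>g\<close> leaves the coefficient alone. Hence both
  \<open>s\<close> and \<open>g\<close> vary in the induction.\<close>

lemma var_class_sum:
  assumes c: "\<And>n. c n \<ge> 1" "\<And>n. \<bar>real_of_int (w n)\<bar> \<le> c n"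
  shows "var_class j g \<Longrightarrow> summable (\<lambda>n. cmod (s n) * c n ^ j) \<Longrightarrow>
    var_class j (\<lambda>N x. \<Sum>n<N. s n * cis (real_of_int (w n) * x) * g n x)"
proof (induction j arbitrary: g s)
  case 0
  then show ?case using uniform_variation_sum by simp
next
  case (Suc j)
  obtain g' where g: "uniform_variation g" "\<And>n x. (g n has_vector_derivative g' n x) (at x)" "var_class j g'"
    using deriv_class_SucE[OF Suc.prems(1)] by blast
  have s: "summable (\<lambda>n. cmod (s n) * c n ^ i)" if "i \<le> Suc j" for i
    by (rule summable_weight_mono[OF Suc.prems(2) c(1) that])
  have "summable (\<lambda>n. cmod (s n * (\<i> * of_int (w n))) * c n ^ j)"
  proof (rule summable_comparison_test'[OF Suc.prems(2)])
    show "norm (cmod (s n * (\<i> * of_int (w n))) * c n ^ j) \<le> cmod (s n) * c n ^ Suc j" for n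
      using c[of n] by (simp add: norm_mult abs_mult mult_left_mono mult_right_mono mult.assoc)
  qed
  then have "var_class j (\<lambda>N x. (\<Sum>n<N. s n * (\<i> * of_int (w n)) * cis (real_of_int (w n) * x) * g n x) +
    (\<Sum>n<N. s n * cis (real_of_int (w n) * x) * g' n x))"
    by (intro var_class_add Suc.IH s var_class_Suc[OF Suc.prems(1)] g(3)) auto
  moreover have "summable (\<lambda>n. cmod (s n))" using s[of 0] by simp
  ultimately show ?case
    by (intro deriv_class_SucI[OF uniform_variation_sum[OF g(1)]
          has_vector_derivative_oscillating_sum[OF g(2)]])
qed

lemma L2_class_sum:
  assumes c: "\<And>n. c n \<ge> 1" "\<And>n. \<bar>real_of_int (w n)\<bar> \<le> c n"
    and c2: "summable (\<lambda>n. (inverse (c n))\<^sup>2)" and w: "inj w"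
  shows "var_class j g \<Longrightarrow> summable (\<lambda>n. (cmod (s n) * c n ^ j)\<^sup>2) \<Longrightarrow>
    L2_class j (\<lambda>N x. \<Sum>n<N. s n * cis (real_of_int (w n) * x) * g n x)"
proof (induction j arbitrary: g s)
  case 0
  then show ?case using L2_cauchy_lacunary_sum[OF _ w] by simp
next
  case (Suc j)
  obtain g' where g: "uniform_variation g" "\<And>n x. (g n has_vector_derivative g' n x) (at x)" "var_class j g'"
    using deriv_class_SucE[OF Suc.prems(1)] by blast
  have sj: "summable (\<lambda>n. cmod (s n) * c n ^ j)"
    by (rule summable_weight_of_square[OF Suc.prems(2) c(1) c2])
  have "summable (\<lambda>n. (cmod (s n * (\<i> * of_int (w n))) * c n ^ j)\<^sup>2)"
  proof (rule summable_comparison_test'[OF Suc.prems(2)])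
    show "norm ((cmod (s n * (\<i> * of_int (w n))) * c n ^ j)\<^sup>2) \<le> (cmod (s n) * c n ^ Suc j)\<^sup>2" for n
    proof -
      have "cmod (s n * (\<i> * of_int (w n))) * c n ^ j \<le> cmod (s n) * c n ^ Suc j"
        using c[of n] by (simp add: norm_mult mult_left_mono mult_right_mono mult.assoc)
      moreover have "cmod (s n * (\<i> * of_int (w n))) * c n ^ j \<ge> 0"
        using c(1)[of n] by simp
      ultimately show ?thesis by (simp add: power_mono)
    qed
  qed
  then have 1: "L2_class j (\<lambda>N x. \<Sum>n<N. s n * (\<i> * of_int (w n)) * cis (real_of_int (w n) * x) * g n x)"
    by (rule Suc.IH[OF var_class_Suc[OF Suc.prems(1)]])
  \<comment> \<open>No weight is spent when the derivative falls on \<open>g\<close>, so absolute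
    summability with weight \<open>j\<close> is enough and this part stays on the uniform
    side.\<close>
  have 2: "L2_class j (\<lambda>N x. \<Sum>n<N. s n * cis (real_of_int (w n) * x) * g' n x)"
    by (intro var_class_imp_L2_class var_class_sum[OF c g(3) sj])
  have "summable (\<lambda>n. cmod (s n))" using summable_weight_mono[OF sj c(1), of 0] by simp
  then show ?case
    by (intro deriv_class_SucI[OF uniform_variation_sum[OF g(1)]
          has_vector_derivative_oscillating_sum[OF g(2)] L2_class_add[OF 1 2]])
qed

section \<open>Transfer coefficients of a half line\<close>

text \<open>Removing the free evolution turns the step z^sigma_3 + Q_n into I + z^(-(n+1) sigma_3)
  Q_n z^(n sigma_3), whose upper right entry is q_n z^(-(2n+1)).\<close>

definition freq :: "nat \<Rightarrow> int" where
  "freq n = - (2 * int n + 1)"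

definition wave :: "(nat \<Rightarrow> complex) \<Rightarrow> nat \<Rightarrow> real \<Rightarrow> complex" where
  "wave p n \<theta> = p n * cis (real_of_int (freq n) * \<theta>)"

text \<open>The pair is the first column (a, b) of the product of the matrices with rows (1, u) and
  (cnj u, 1). Their symmetry makes the second column (cnj b, cnj a), so it need not be
  stored.\<close>

primrec transfer :: "(nat \<Rightarrow> complex) \<Rightarrow> nat \<Rightarrow> real \<Rightarrow> complex \<times> complex" where
  "transfer p 0 \<theta> = (1, 0)"
| "transfer p (Suc n) \<theta> =
     (fst (transfer p n \<theta>) + wave p n \<theta> * snd (transfer p n \<theta>),
      snd (transfer p n \<theta>) + cnj (wave p n \<theta>) * fst (transfer p n \<theta>))"

definition transfer_a :: "(nat \<Rightarrow> complex) \<Rightarrow> nat \<Rightarrow> real \<Rightarrow> complex" where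
  "transfer_a p n \<theta> = fst (transfer p n \<theta>)"

definition transfer_b :: "(nat \<Rightarrow> complex) \<Rightarrow> nat \<Rightarrow> real \<Rightarrow> complex" where
  "transfer_b p n \<theta> = snd (transfer p n \<theta>)"

definition transfer_det :: "(nat \<Rightarrow> complex) \<Rightarrow> nat \<Rightarrow> real" where
  "transfer_det p n = (\<Prod>m<n. 1 - (cmod (p m))\<^sup>2)"

lemma transfer_a_0: "transfer_a p 0 \<theta> = 1"
  and transfer_b_0: "transfer_b p 0 \<theta> = 0"
  and transfer_a_Suc: "transfer_a p (Suc n) \<theta> = transfer_a p n \<theta> + wave p n \<theta> * transfer_b p n \<theta>"
  and transfer_b_Suc: "transfer_b p (Suc n) \<theta> = transfer_b p n \<theta> + cnj (wave p n \<theta>) * transfer_a p n \<theta>"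
  by (simp_all add: transfer_a_def transfer_b_def)

lemma transfer_det_0: "transfer_det p 0 = 1"
  and transfer_det_Suc: "transfer_det p (Suc n) = transfer_det p n * (1 - (cmod (p n))\<^sup>2)"
  by (simp_all add: transfer_det_def)

lemma transfer_det_nonzero:
  assumes "\<And>n. cmod (p n) < 1"
  shows "transfer_det p n \<noteq> 0"
proof -
  have "(cmod (p m))\<^sup>2 < 1" for m
    using assms[of m] by (simp add: abs_square_less_1)
  then show ?thesis
    by (simp add: transfer_det_def less_imp_neq)
qed

lemma cmod_wave [simp]: "cmod (wave p n \<theta>) = cmod (p n)"
  by (simp add: wave_def norm_mult)

text \<open>Multiplicativity of the determinant: each factor contributes 1 - u cnj u.\<close>

lemma transfer_determinant:
  "transfer_a p n \<theta> * cnj (transfer_a p n \<theta>) - transfer_b p n \<theta> * cnj (transfer_b p n \<theta>) =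
    complex_of_real (transfer_det p n)"
proof (induction n)
  case 0
  then show ?case by (simp add: transfer_a_0 transfer_b_0 transfer_det_0)
next
  case (Suc n)
  have u: "wave p n \<theta> * cnj (wave p n \<theta>) = complex_of_real ((cmod (p n))\<^sup>2)"
    using complex_norm_square[of "wave p n \<theta>"] by simp
  have "transfer_a p (Suc n) \<theta> * cnj (transfer_a p (Suc n) \<theta>) -
      transfer_b p (Suc n) \<theta> * cnj (transfer_b p (Suc n) \<theta>) =
    (transfer_a p n \<theta> * cnj (transfer_a p n \<theta>) - transfer_b p n \<theta> * cnj (transfer_b p n \<theta>)) *
    (1 - wave p n \<theta> * cnj (wave p n \<theta>))"
    by (simp add: transfer_a_Suc transfer_b_Suc algebra_simps)
  then show ?case
    by (simp only: Suc u transfer_det_Suc of_real_mult of_real_diff of_real_1)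
qed

lemma continuous_periodic_wave: "continuous_periodic (wave p n)"
  unfolding wave_def
  by (intro continuous_periodic_mult continuous_periodic_const continuous_periodic_cis)

lemma continuous_periodic_transfer:
  "continuous_periodic (transfer_a p n) \<and> continuous_periodic (transfer_b p n)"
proof (induction n)
  case 0
  then show ?case by (simp add: transfer_a_0 transfer_b_0 continuous_periodic_const)
next
  case (Suc n)
  then show ?case
    unfolding transfer_a_Suc transfer_b_Suc
    by (auto intro!: continuous_periodic_add continuous_periodic_mult continuous_periodic_cnj
        continuous_periodic_wave)
qed

text \<open>
  The first column of \<open>Z\<^sub>N\<close>; the determinants come from inverting \<open>\<Phi>\<^bsub>n+1\<^esub>\<close>.
\<close>

definition gauge_a :: "(nat \<Rightarrow> complex) \<Rightarrow> nat \<Rightarrow> real \<Rightarrow> complex" where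
  "gauge_a p N \<theta> =
    (\<Sum>n<N. p n * (\<i> * of_int (freq n)) * cis (real_of_int (freq n) * \<theta>) *
       (transfer_b p n \<theta> * cnj (transfer_a p (Suc n) \<theta>) * inverse (of_real (transfer_det p (Suc n))))) +
    (\<Sum>n<N. - cnj (p n * (\<i> * of_int (freq n))) * cis (real_of_int (- freq n) * \<theta>) *
       (transfer_a p n \<theta> * cnj (transfer_b p (Suc n) \<theta>) * inverse (of_real (transfer_det p (Suc n)))))"

definition gauge_b :: "(nat \<Rightarrow> complex) \<Rightarrow> nat \<Rightarrow> real \<Rightarrow> complex" where
  "gauge_b p N \<theta> =
    (\<Sum>n<N. cnj (p n * (\<i> * of_int (freq n))) * cis (real_of_int (- freq n) * \<theta>) *
       (transfer_a p n \<theta> * transfer_a p (Suc n) \<theta> * inverse (of_real (transfer_det p (Suc n))))) +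
    (\<Sum>n<N. - (p n * (\<i> * of_int (freq n))) * cis (real_of_int (freq n) * \<theta>) *
       (transfer_b p n \<theta> * transfer_b p (Suc n) \<theta> * inverse (of_real (transfer_det p (Suc n)))))"

text \<open>
  The barred variables stand for complex conjugates; treating them as independent makes the
  identities polynomial modulo the determinant relation.
\<close>

lemma gauge_identity:
  fixes a b a' b' u u' v v' z w \<kappa> :: complex
  assumes "\<kappa> * ((a + u * b) * (a' + u' * b') - (b + u' * a) * (b' + u * a')) = 1"
  shows "(a * z + b' * w) + (u * (b * z + a' * w) + v * b) =
      (a + u * b) * (z + \<kappa> * (v * b * (a' + u' * b') - v' * a * (b' + u * a'))) +
      (b' + u * a') * (w + \<kappa> * (v' * a * (a + u * b) - v * b * (b + u' * a)))"
    and "(b * z + a' * w) + (u' * (a * z + b' * w) + v' * a) =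
      (b + u' * a) * (z + \<kappa> * (v * b * (a' + u' * b') - v' * a * (b' + u * a'))) +
      (a' + u' * b') * (w + \<kappa> * (v' * a * (a + u * b) - v * b * (b + u' * a)))"
proof -
  let ?D = "\<kappa> * ((a + u * b) * (a' + u' * b') - (b + u' * a) * (b' + u * a'))"
  have "(a + u * b) * (z + \<kappa> * (v * b * (a' + u' * b') - v' * a * (b' + u * a'))) +
      (b' + u * a') * (w + \<kappa> * (v' * a * (a + u * b) - v * b * (b + u' * a))) =
      (a + u * b) * z + (b' + u * a') * w + v * b * ?D"
    by (simp add: algebra_simps)
  then show "(a * z + b' * w) + (u * (b * z + a' * w) + v * b) =
      (a + u * b) * (z + \<kappa> * (v * b * (a' + u' * b') - v' * a * (b' + u * a'))) +
      (b' + u * a') * (w + \<kappa> * (v' * a * (a + u * b) - v * b * (b + u' * a)))"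
    unfolding assms by (simp add: algebra_simps)
  have "(b + u' * a) * (z + \<kappa> * (v * b * (a' + u' * b') - v' * a * (b' + u * a'))) +
      (a' + u' * b') * (w + \<kappa> * (v' * a * (a + u * b) - v * b * (b + u' * a))) =
      (b + u' * a) * z + (a' + u' * b') * w + v' * a * ?D"
    by (simp add: algebra_simps)
  then show "(b * z + a' * w) + (u' * (a * z + b' * w) + v' * a) =
      (b + u' * a) * (z + \<kappa> * (v * b * (a' + u' * b') - v' * a * (b' + u * a'))) +
      (a' + u' * b') * (w + \<kappa> * (v' * a * (a + u * b) - v * b * (b + u' * a)))"
    unfolding assms by (simp add: algebra_simps)
qed

lemma has_vector_derivative_wave:
  "(wave p n has_vector_derivative p n * (\<i> * of_int (freq n)) * cis (real_of_int (freq n) * x)) (at x)"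
  using has_vector_derivative_mult_right[OF has_vector_derivative_cis_mult[of "freq n" x UNIV], of "p n"]
  by (simp add: wave_def[abs_def] mult.assoc)

text \<open>The first column of Phi' = Phi Z. In the induction step, the inverse of the new Phi
  built into the increment of Z cancels against Phi by the determinant relation, leaving exactly
  A_n' Phi_n.\<close>

lemma has_vector_derivative_transfer:
  assumes "\<And>n. cmod (p n) < 1"
  shows "(transfer_a p n has_vector_derivative
      transfer_a p n x * gauge_a p n x + cnj (transfer_b p n x) * gauge_b p n x) (at x) \<and>
    (transfer_b p n has_vector_derivative
      transfer_b p n x * gauge_a p n x + cnj (transfer_a p n x) * gauge_b p n x) (at x)"
proof (induction n)
  case 0
  then show ?case
    by (simp add: transfer_a_0 transfer_b_0 gauge_a_def gauge_b_def)
next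
  case (Suc n)
  define v where "v = p n * (\<i> * of_int (freq n)) * cis (real_of_int (freq n) * x)"
  let ?a = "transfer_a p n x" and ?b = "transfer_b p n x" and ?u = "wave p n x"
  let ?z = "gauge_a p n x" and ?w = "gauge_b p n x"
  let ?\<kappa> = "inverse (complex_of_real (transfer_det p (Suc n)))"
  have nz: "transfer_det p (Suc n) \<noteq> 0"
    by (rule transfer_det_nonzero) (rule assms)
  have cv: "cnj v = cnj (p n * (\<i> * of_int (freq n))) * cis (real_of_int (- freq n) * x)"
    by (simp add: v_def cis_cnj)
  have u: "(wave p n has_vector_derivative v) (at x)"
    unfolding v_def by (rule has_vector_derivative_wave)
  have 1: "gauge_a p (Suc n) x = ?z + ?\<kappa> * (v * ?b * (cnj ?a + cnj ?u * cnj ?b) - cnj v * ?a * (cnj ?b + ?u * cnj ?a))"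
    unfolding gauge_a_def cv by (simp add: transfer_a_Suc transfer_b_Suc v_def algebra_simps)
  have 2: "gauge_b p (Suc n) x = ?w + ?\<kappa> * (cnj v * ?a * (?a + ?u * ?b) - v * ?b * (?b + cnj ?u * ?a))"
    unfolding gauge_b_def cv by (simp add: transfer_a_Suc transfer_b_Suc v_def algebra_simps)
  have det: "?\<kappa> * ((?a + ?u * ?b) * (cnj ?a + cnj ?u * cnj ?b) - (?b + cnj ?u * ?a) * (cnj ?b + ?u * cnj ?a)) = 1"
    using transfer_determinant[of p "Suc n" x] nz by (simp add: transfer_a_Suc transfer_b_Suc)
  have "(transfer_a p (Suc n) has_vector_derivative
      (?a * ?z + cnj ?b * ?w) + (?u * (?b * ?z + cnj ?a * ?w) + v * ?b)) (at x)"
    unfolding transfer_a_Suc[abs_def]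
    using Suc by (intro has_vector_derivative_add has_vector_derivative_mult u) auto
  moreover have "(transfer_b p (Suc n) has_vector_derivative
      (?b * ?z + cnj ?a * ?w) + (cnj ?u * (?a * ?z + cnj ?b * ?w) + cnj v * ?a)) (at x)"
    unfolding transfer_b_Suc[abs_def]
    using Suc by (intro has_vector_derivative_add has_vector_derivative_mult has_vector_derivative_cnj u) auto
  moreover have "transfer_a p (Suc n) x * gauge_a p (Suc n) x + cnj (transfer_b p (Suc n) x) * gauge_b p (Suc n) x =
      (?a * ?z + cnj ?b * ?w) + (?u * (?b * ?z + cnj ?a * ?w) + v * ?b)"
    unfolding gauge_identity(1)[OF det, where z = ?z and w = ?w and v = v and v' = "cnj v"] 1 2
    by (simp add: transfer_a_Suc transfer_b_Suc)
  moreover have "transfer_b p (Suc n) x * gauge_a p (Suc n) x + cnj (transfer_a p (Suc n) x) * gauge_b p (Suc n) x =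
      (?b * ?z + cnj ?a * ?w) + (cnj ?u * (?a * ?z + cnj ?b * ?w) + cnj v * ?a)"
    unfolding gauge_identity(2)[OF det, where z = ?z and w = ?w and v = v and v' = "cnj v"] 1 2
    by (simp add: transfer_a_Suc transfer_b_Suc)
  ultimately show ?case by (simp only:)
qed

text \<open>The weight is the modulus of \<open>freq n\<close>, so each derivative costs exactly one
  power of it. Writing the exponent as \<open>Suc j\<close> guarantees at least one power, enough
  for \<open>p\<close> to be absolutely summable.\<close>

locale half_line =
  fixes p :: "nat \<Rightarrow> complex" and j :: nat and \<rho> :: real
  assumes p_bound: "\<And>n. cmod (p n) \<le> \<rho>" and \<rho>: "\<rho> < 1"
    and p_summable: "summable (\<lambda>n. (cmod (p n) * (2 * real n + 1) ^ Suc j)\<^sup>2)"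
begin

lemma p_less_1: "cmod (p n) < 1"
  using p_bound[of n] \<rho> by linarith

section \<open>Summability and bounds on one half line\<close>

lemma summable_inverse_odd: "summable (\<lambda>n. (inverse (2 * real n + 1))\<^sup>2)"
proof (rule summable_comparison_test'[of "\<lambda>n. inverse (real (Suc n)) ^ 2"])
  show "summable (\<lambda>n. (inverse (real (Suc n)))\<^sup>2)"
    using inverse_power_summable[of 2, where ?'a = real] by (subst summable_Suc_iff)(simp add: power_inverse)
  show "norm ((inverse (2 * real n + 1))\<^sup>2) \<le> (inverse (real (Suc n)))\<^sup>2" for n
    by (simp add: power_mono le_imp_inverse_le)
qed

lemma summable_p: "summable (\<lambda>n. cmod (p n) * (2 * real n + 1) ^ j)"
  by (rule summable_weight_of_square[OF p_summable _ summable_inverse_odd]) simp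

lemma summable_p0: "summable (\<lambda>n. cmod (p n))"
  using summable_weight_mono[OF summable_p, of 0] by simp

lemma summable_p_square: "summable (\<lambda>n. (cmod (p n))\<^sup>2)"
proof (rule summable_comparison_test'[OF summable_p0])
  show "norm ((cmod (p n))\<^sup>2) \<le> cmod (p n)" for n
    using p_less_1[of n] by (simp add: power2_eq_square mult_left_le)
qed

text \<open>For x between 0 and \<rho>^2 and c = 1 - \<rho>^2 one has c \<le> 1 - x, hence 1 \<le>
  (1 - x)(1 + x/c) \<le> (1 - x) exp (x/c). The infinite product is thus bounded below by the
  exponential of a convergent sum.\<close>

lemma transfer_det_lower: obtains \<delta> where "\<delta> > 0" "\<And>n. transfer_det p n \<ge> \<delta>"
proof
  let ?c = "1 - \<rho>\<^sup>2"
  have \<rho>0: "\<rho> \<ge> 0" using p_bound[of 0] norm_ge_zero order_trans by blast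
  have c: "?c > 0" using \<rho> \<rho>0 by (simp add: abs_square_less_1)
  show "exp (- (suminf (\<lambda>n. (cmod (p n))\<^sup>2) / ?c)) > 0" by simp
  show "exp (- (suminf (\<lambda>n. (cmod (p n))\<^sup>2) / ?c)) \<le> transfer_det p n" for n
  proof -
    have f: "exp (- ((cmod (p m))\<^sup>2 / ?c)) \<le> 1 - (cmod (p m))\<^sup>2" for m
    proof -
      let ?x = "(cmod (p m))\<^sup>2"
      have x: "0 \<le> ?x" "?x \<le> \<rho>\<^sup>2" using p_bound[of m] by (auto intro: power_mono)
      have "?x * ?c \<le> ?x * (1 - ?x)" using x by (intro mult_left_mono) auto
      then have "1 \<le> (1 - ?x) * (1 + ?x / ?c)" using c by (simp add: field_simps)
      also have "\<dots> \<le> (1 - ?x) * exp (?x / ?c)"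
        using x c exp_ge_add_one_self[of "?x / ?c"] by (intro mult_left_mono) auto
      finally show ?thesis by (simp add: exp_minus field_simps)
    qed
    have "exp (- (suminf (\<lambda>n. (cmod (p n))\<^sup>2) / ?c)) \<le> exp (- ((\<Sum>m<n. (cmod (p m))\<^sup>2) / ?c))"
      using sum_le_suminf[OF summable_p_square, of "{..<n}"] c by (simp add: divide_right_mono)
    also have "\<dots> = (\<Prod>m<n. exp (- ((cmod (p m))\<^sup>2 / ?c)))"
      by (simp add: exp_sum[symmetric] sum_negf sum_divide_distrib)
    also have "\<dots> \<le> transfer_det p n"
      unfolding transfer_det_def by (intro prod_mono) (simp add: f)
    finally show ?thesis .
  qed
qed

lemma transfer_det_le_1: "0 \<le> transfer_det p n \<and> transfer_det p n \<le> 1"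
  using p_less_1 unfolding transfer_det_def
  by (auto intro!: prod_nonneg prod_le_1 simp: abs_square_le_1 less_imp_le)

text \<open>A discrete Gronwall estimate: each factor enlarges the l1 norm of the column by at most
  1 + |p n| \<le> exp |p n|.\<close>

lemma transfer_bound:
  "cmod (transfer_a p n x) + cmod (transfer_b p n x) \<le> exp (suminf (\<lambda>n. cmod (p n)))"
proof -
  have "cmod (transfer_a p n x) + cmod (transfer_b p n x) \<le> exp (\<Sum>m<n. cmod (p m))"
  proof (induction n)
    case 0
    then show ?case by (simp add: transfer_a_0 transfer_b_0)
  next
    case (Suc n)
    let ?a = "cmod (transfer_a p n x)" and ?b = "cmod (transfer_b p n x)"
    have "cmod (transfer_a p (Suc n) x) \<le> ?a + cmod (p n) * ?b"
      unfolding transfer_a_Suc by (rule order_trans[OF norm_triangle_ineq]) (simp add: norm_mult)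
    moreover have "cmod (transfer_b p (Suc n) x) \<le> ?b + cmod (p n) * ?a"
      unfolding transfer_b_Suc by (rule order_trans[OF norm_triangle_ineq]) (simp add: norm_mult)
    ultimately have "cmod (transfer_a p (Suc n) x) + cmod (transfer_b p (Suc n) x) \<le> (1 + cmod (p n)) * (?a + ?b)"
      by (simp add: algebra_simps)
    also have "\<dots> \<le> exp (cmod (p n)) * exp (\<Sum>m<n. cmod (p m))"
      by (intro mult_mono Suc exp_ge_add_one_self) auto
    finally show ?case by (simp add: exp_add[symmetric] add.commute)
  qed
  also have "\<dots> \<le> exp (suminf (\<lambda>n. cmod (p n)))"
    using sum_le_suminf[OF summable_p0, of "{..<n}"] by simp
  finally show ?thesis .
qed

lemma uniform_variation_transfer:
  "uniform_variation (transfer_a p)" "uniform_variation (transfer_b p)"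
proof -
  let ?B = "exp (suminf (\<lambda>n. cmod (p n)))"
  have ab: "cmod (transfer_a p n x) \<le> ?B" "cmod (transfer_b p n x) \<le> ?B" for n x
    using transfer_bound[of n x] norm_ge_zero[of "transfer_a p n x"] norm_ge_zero[of "transfer_b p n x"]
    by linarith+
  have s: "summable (\<lambda>n. cmod (p n) * ?B)" by (intro summable_mult2 summable_p0)
  show "uniform_variation (transfer_a p)"
    by (rule uniform_variationI[OF _ ab(1) s])
      (auto simp: continuous_periodic_transfer transfer_a_Suc norm_mult ab mult_left_mono)
  show "uniform_variation (transfer_b p)"
    by (rule uniform_variationI[OF _ ab(2) s])
      (auto simp: continuous_periodic_transfer transfer_b_Suc norm_mult ab mult_left_mono)
qed

text \<open>The index is shifted because the gauge sums invert Phi at n + 1. The determinants change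
  by at most |p n|^2 per step and stay away from zero.\<close>

lemma var_class_inverse_det: "var_class i (\<lambda>n x. inverse (complex_of_real (transfer_det p (Suc n))))"
proof -
  have "summable (\<lambda>n. cmod (complex_of_real (transfer_det p (Suc n)) - complex_of_real (transfer_det p n)))"
  proof (rule summable_comparison_test'[OF summable_p_square])
    fix n
    have "complex_of_real (transfer_det p (Suc n)) - complex_of_real (transfer_det p n) =
        complex_of_real (- (transfer_det p n * (cmod (p n))\<^sup>2))"
      by (simp add: transfer_det_Suc algebra_simps)
    then have "cmod (complex_of_real (transfer_det p (Suc n)) - complex_of_real (transfer_det p n)) =
        transfer_det p n * (cmod (p n))\<^sup>2"
      using transfer_det_le_1[of n] by (simp only: norm_of_real) simp
    also have "\<dots> \<le> 1 * (cmod (p n))\<^sup>2"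
      using transfer_det_le_1[of n] by (intro mult_right_mono) auto
    finally show "norm (cmod (complex_of_real (transfer_det p (Suc n)) - complex_of_real (transfer_det p n)))
        \<le> (cmod (p n))\<^sup>2" by simp
  qed
  then have "var_class i (\<lambda>n x. complex_of_real (transfer_det p n))"
    by (rule var_class_const)
  then have v: "var_class i (\<lambda>n x. complex_of_real (transfer_det p (Suc n)))"
    by (rule var_class_shift)
  obtain \<delta> where \<delta>: "\<delta> > 0" "\<And>n. transfer_det p n \<ge> \<delta>" using transfer_det_lower by blast
  have "cmod (complex_of_real (transfer_det p (Suc n))) \<ge> \<delta>" for n
    using \<delta>(1) \<delta>(2)[of "Suc n"] by simp
  then show ?thesis using var_class_inverse[OF \<delta>(1) _ v] by blast
qed

text \<open>One pass, generic in \<open>P\<close>: the uniform passes and the last one differ in the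
  argument for \<open>osc\<close>. Both signs of the frequency occur because the off-diagonal
  entries of A_n' are conjugate to each other.\<close>

lemma deriv_class_transfer_Suc:
  assumes add: "\<And>f g. deriv_class P i f \<Longrightarrow> deriv_class P i g \<Longrightarrow> deriv_class P i (\<lambda>n x. f n x + g n x)"
    and mult: "\<And>f g. deriv_class P i f \<Longrightarrow> var_class i g \<Longrightarrow> deriv_class P i (\<lambda>n x. f n x * g n x)"
    and osc: "\<And>s w g. (\<And>n. cmod (s n) = cmod (p n) * (2 * real n + 1)) \<Longrightarrow> w = freq \<or> w = (\<lambda>n. - freq n) \<Longrightarrow>
      var_class i g \<Longrightarrow> deriv_class P i (\<lambda>N x. \<Sum>n<N. s n * cis (real_of_int (w n) * x) * g n x)"
    and ab: "var_class i (transfer_a p)" "var_class i (transfer_b p)"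
  shows "deriv_class P (Suc i) (transfer_a p)" "deriv_class P (Suc i) (transfer_b p)"
proof -
  note sh = var_class_shift[OF ab(1)] var_class_shift[OF ab(2)]
  have ns: "cmod (p n * (\<i> * of_int (freq n))) = cmod (p n) * (2 * real n + 1)" for n
    by (simp only: norm_mult norm_ii norm_of_int) (simp add: freq_def)
  have za: "deriv_class P i (gauge_a p)"
    unfolding gauge_a_def[abs_def]
    by (intro add osc var_class_mult var_class_inverse_det ab var_class_cnj sh)
      (simp_all only: norm_minus_cancel complex_mod_cnj ns simp_thms)
  have zb: "deriv_class P i (gauge_b p)"
    unfolding gauge_b_def[abs_def]
    by (intro add osc var_class_mult var_class_inverse_det ab var_class_cnj sh)
      (simp_all only: norm_minus_cancel complex_mod_cnj ns simp_thms)
  \<comment> \<open>\<open>mult\<close> expects the factor of class \<open>P\<close> on the left, so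
    the gauge terms are put in front and commuted back afterwards.\<close>
  have "deriv_class P i (\<lambda>n x. gauge_a p n x * transfer_a p n x + gauge_b p n x * cnj (transfer_b p n x))"
    by (intro add mult za zb ab var_class_cnj)
  then have 1: "deriv_class P i (\<lambda>n x. transfer_a p n x * gauge_a p n x + cnj (transfer_b p n x) * gauge_b p n x)"
    by (simp only: mult.commute)
  have "deriv_class P i (\<lambda>n x. gauge_a p n x * transfer_b p n x + gauge_b p n x * cnj (transfer_a p n x))"
    by (intro add mult za zb ab var_class_cnj)
  then have 2: "deriv_class P i (\<lambda>n x. transfer_b p n x * gauge_a p n x + cnj (transfer_a p n x) * gauge_b p n x)"
    by (simp only: mult.commute)
  show "deriv_class P (Suc i) (transfer_a p)"
    by (rule deriv_class_SucI[OF uniform_variation_transfer(1) _ 1])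
      (simp add: has_vector_derivative_transfer p_less_1)
  show "deriv_class P (Suc i) (transfer_b p)"
    by (rule deriv_class_SucI[OF uniform_variation_transfer(2) _ 2])
      (simp add: has_vector_derivative_transfer p_less_1)
qed

lemma freq_bound: "w = freq \<or> w = (\<lambda>n. - freq n) \<Longrightarrow> \<bar>real_of_int (w n)\<bar> \<le> 2 * real n + 1"
  by (auto simp: freq_def)

text \<open>Reaching level i + 1 takes absolute summability with weight i + 1, which is available up
  to \<open>j\<close>.\<close>

lemma var_class_transfer: "i \<le> j \<Longrightarrow> var_class i (transfer_a p) \<and> var_class i (transfer_b p)"
proof (induction i)
  case 0
  then show ?case using uniform_variation_transfer by simp
next
  case (Suc i)
  have osc: "var_class i (\<lambda>N x. \<Sum>n<N. s n * cis (real_of_int (w n) * x) * g n x)"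
    if s: "\<And>n. cmod (s n) = cmod (p n) * (2 * real n + 1)" and w: "w = freq \<or> w = (\<lambda>n. - freq n)"
      and g: "var_class i g" for s w g
  proof (rule var_class_sum[OF _ freq_bound[OF w] g])
    have "summable (\<lambda>n. cmod (p n) * (2 * real n + 1) ^ Suc i)"
      by (rule summable_weight_mono[OF summable_p _ Suc.prems]) simp
    then show "summable (\<lambda>n. cmod (s n) * (2 * real n + 1) ^ i)"
      by (simp add: s mult.assoc)
  qed simp
  have ab: "var_class i (transfer_a p)" "var_class i (transfer_b p)"
    using Suc by simp_all
  show ?case
    by (intro conjI; rule deriv_class_transfer_Suc[where P = uniform_variation])
      (rule ab | erule (1) var_class_add | erule (1) var_class_mult | (rule osc; assumption))+
qed

text \<open>This pass would need weight \<open>Suc j\<close>, which \<open>p\<close> carries only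
  square summably. \<open>L2_class_sum\<close> accepts that in return for distinct
  frequencies.\<close>

lemma L2_class_transfer: "L2_class (Suc j) (transfer_a p)" "L2_class (Suc j) (transfer_b p)"
proof -
  have osc: "L2_class j (\<lambda>N x. \<Sum>n<N. s n * cis (real_of_int (w n) * x) * g n x)"
    if s: "\<And>n. cmod (s n) = cmod (p n) * (2 * real n + 1)" and w: "w = freq \<or> w = (\<lambda>n. - freq n)"
      and g: "var_class j g" for s w g
  proof (rule L2_class_sum[OF _ freq_bound[OF w] summable_inverse_odd _ g])
    show "inj w" using w by (auto simp: inj_def freq_def)
    show "summable (\<lambda>n. (cmod (s n) * (2 * real n + 1) ^ j)\<^sup>2)"
      using p_summable by (simp add: s mult.assoc)
  qed simp
  have ab: "var_class j (transfer_a p)" "var_class j (transfer_b p)"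
    using var_class_transfer by simp_all
  show "L2_class (Suc j) (transfer_a p)" "L2_class (Suc j) (transfer_b p)"
    by (rule deriv_class_transfer_Suc[where P = L2_cauchy];
        (rule ab | erule (1) L2_class_add | erule (1) L2_var_class_mult | (rule osc; assumption)))+
qed

end

section \<open>Jost solutions and the reflection coefficient\<close>

definition mat2 :: "complex \<Rightarrow> complex \<Rightarrow> complex \<Rightarrow> complex \<Rightarrow> complex^2^2" where
  "mat2 a b c d = vector [vector [a, b], vector [c, d]]"

lemma mat2_nth [simp]:
  "mat2 a b c d $ 1 $ 1 = a" "mat2 a b c d $ 1 $ 2 = b"
  "mat2 a b c d $ 2 $ 1 = c" "mat2 a b c d $ 2 $ 2 = d"
  by (simp_all add: mat2_def)

lemma mat2_eq_iff: "mat2 a b c d = mat2 a' b' c' d' \<longleftrightarrow> a = a' \<and> b = b' \<and> c = c' \<and> d = d'"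
  by (auto simp: vec_eq_iff forall_2)

lemma mat2_mult:
  "mat2 a b c d ** mat2 a' b' c' d' =
    mat2 (a * a' + b * c') (a * b' + b * d') (c * a' + d * c') (c * b' + d * d')"
  by (simp add: vec_eq_iff forall_2 matrix_matrix_mult_def sum_2)

lemma mat2_add: "mat2 a b c d + mat2 a' b' c' d' = mat2 (a + a') (b + b') (c + c') (d + d')"
  by (simp add: vec_eq_iff forall_2)

lemma mat2_one: "mat 1 = mat2 1 0 0 1"
  by (simp add: vec_eq_iff forall_2 mat_def)

lemma z_sigma3_eq: "z_sigma3 z n = mat2 (z powi n) 0 0 (z powi (- n))"
  by (simp add: z_sigma3_def mat2_def)

lemma potential_eq: "potential q n = mat2 0 (q n) (cnj (q n)) 0"
  by (simp add: potential_def mat2_def)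

lemma tendsto_mat2:
  assumes "(a \<longlongrightarrow> a') F" "(b \<longlongrightarrow> b') F" "(c \<longlongrightarrow> c') F" "(d \<longlongrightarrow> d') F"
  shows "((\<lambda>x. mat2 (a x) (b x) (c x) (d x)) \<longlongrightarrow> mat2 a' b' c' d') F"
proof (rule vec_tendstoI, rule vec_tendstoI)
  fix i j :: 2
  show "((\<lambda>x. mat2 (a x) (b x) (c x) (d x) $ i $ j) \<longlongrightarrow> mat2 a' b' c' d' $ i $ j) F"
    using exhaust_2[of i] exhaust_2[of j] assms by auto
qed

lemma tendsto_matrix_mult_const:
  fixes B :: "complex^2^2"
  assumes "(A \<longlongrightarrow> L) F"
  shows "((\<lambda>x. A x ** B) \<longlongrightarrow> L ** B) F"
  unfolding matrix_matrix_mult_def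
  by (intro tendsto_vec_lambda tendsto_sum tendsto_mult tendsto_const tendsto_vec_nth assms)

section \<open>Uniqueness of solutions and the scattering matrix\<close>

lemma spectral_solution_mult:
  "spectral_solution q z X \<Longrightarrow> spectral_solution q z (\<lambda>n. X n ** C)"
  by (simp add: spectral_solution_def matrix_mul_assoc)

text \<open>The step matrix has determinant 1 - |q n|^2, which is nonzero, so the recursion can also
  be run backwards from site 0.\<close>

lemma spectral_solution_unique:
  assumes z: "z \<noteq> 0" and q: "\<And>n. cmod (q n) < 1"
    and X: "spectral_solution q z X" and Y: "spectral_solution q z Y" and eq: "X 0 = Y 0"
  shows "X n = Y n"
proof -
  have cancel: "U = V"
    if "(z_sigma3 z 1 + potential q n) ** U = (z_sigma3 z 1 + potential q n) ** V" for n U V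
  proof -
    let ?d = "1 - q n * cnj (q n)"
    have "(cmod (q n))\<^sup>2 < 1" using q[of n] by (simp add: abs_square_less_1)
    then have d: "?d \<noteq> 0"
      by (metis complex_norm_square eq_iff_diff_eq_0 less_irrefl of_real_eq_1_iff)
    \<comment> \<open>The adjugate divided by the determinant.\<close>
    have inv: "mat2 (inverse z / ?d) (- q n / ?d) (- cnj (q n) / ?d) (z / ?d) ** (z_sigma3 z 1 + potential q n) = mat 1"
      using z d unfolding z_sigma3_eq potential_eq mat2_add mat2_mult mat2_one mat2_eq_iff
      by (simp add: power_int_minus divide_simps)
    have "mat2 (inverse z / ?d) (- q n / ?d) (- cnj (q n) / ?d) (z / ?d) **
        ((z_sigma3 z 1 + potential q n) ** U) =
      mat2 (inverse z / ?d) (- q n / ?d) (- cnj (q n) / ?d) (z / ?d) **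
        ((z_sigma3 z 1 + potential q n) ** V)"
      by (simp only: that)
    then show ?thesis by (simp only: matrix_mul_assoc inv matrix_mul_lid)
  qed
  show ?thesis
  proof (induction n rule: int_induct[where k = 0])
    case base
    then show ?case by (rule eq)
  next
    case (step1 i)
    then show ?case using X Y by (simp add: spectral_solution_def)
  next
    case (step2 i)
    have "X (i - 1 + 1) = Y (i - 1 + 1)" using step2 by simp
    moreover have "X (i - 1 + 1) = (z_sigma3 z 1 + potential q (i - 1)) ** X (i - 1)"
      "Y (i - 1 + 1) = (z_sigma3 z 1 + potential q (i - 1)) ** Y (i - 1)"
      using X Y unfolding spectral_solution_def by blast+
    ultimately have "(z_sigma3 z 1 + potential q (i - 1)) ** X (i - 1) =
        (z_sigma3 z 1 + potential q (i - 1)) ** Y (i - 1)"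
      by metis
    then show ?case by (rule cancel)
  qed
qed

text \<open>Since \<open>X 0\<close> is the identity, every solution is \<open>X n ** Y 0\<close>;
  passing to the limit gives \<open>L ** Y 0 = mat 1\<close>, which fixes \<open>Y 0\<close>. The
  filter \<open>F\<close> lets one argument serve both Jost solutions.\<close>

lemma normalised_solution_unique:
  assumes z: "z \<noteq> 0" and q: "\<And>n. cmod (q n) < 1"
    and X: "spectral_solution q z X" and X0: "X 0 = mat 1"
    and lim: "((\<lambda>n. z_sigma3 z (- n) ** X n) \<longlongrightarrow> L) F" and F: "F \<noteq> bot" and L: "L ** L' = mat 1"
  shows "(THE Y. spectral_solution q z Y \<and> ((\<lambda>n. z_sigma3 z (- n) ** Y n) \<longlongrightarrow> mat 1) F) =
    (\<lambda>n. X n ** L')"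
proof (rule the_equality)
  show "spectral_solution q z (\<lambda>n. X n ** L') \<and>
      ((\<lambda>n. z_sigma3 z (- n) ** (X n ** L')) \<longlongrightarrow> mat 1) F"
    using tendsto_matrix_mult_const[OF lim, of L'] spectral_solution_mult[OF X] L
    by (simp add: matrix_mul_assoc)
next
  fix Y
  assume Y: "spectral_solution q z Y \<and> ((\<lambda>n. z_sigma3 z (- n) ** Y n) \<longlongrightarrow> mat 1) F"
  have eq: "Y n = X n ** Y 0" for n
  proof (rule spectral_solution_unique[OF z q _ spectral_solution_mult[OF X]])
    show "spectral_solution q z Y" using Y by blast
    show "Y 0 = X 0 ** Y 0" by (simp add: X0)
  qed
  have "(\<lambda>n. z_sigma3 z (- n) ** Y n) = (\<lambda>n. z_sigma3 z (- n) ** X n ** Y 0)"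
    by (rule ext) (subst eq, simp only: matrix_mul_assoc)
  then have "((\<lambda>n. z_sigma3 z (- n) ** X n ** Y 0) \<longlongrightarrow> mat 1) F"
    using Y by simp
  moreover have "((\<lambda>n. z_sigma3 z (- n) ** X n ** Y 0) \<longlongrightarrow> L ** Y 0) F"
    by (rule tendsto_matrix_mult_const[OF lim])
  ultimately have "L ** Y 0 = mat 1"
    using tendsto_unique[OF F] by blast
  moreover have "L' ** L = mat 1" using L matrix_left_right_inverse by blast
  then have "Y 0 = L' ** (L ** Y 0)" by (simp add: matrix_mul_assoc)
  ultimately have "Y 0 = L'" by simp
  then have "Y n = X n ** L'" for n using eq[of n] by (simp only:)
  then show "Y = (\<lambda>n. X n ** L')" by (rule ext)
qed

text \<open>The Jost solutions are \<open>X n ** L'\<close> and \<open>X n ** M'\<close>, so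
  \<open>S\<close> has to satisfy \<open>M' = L' ** S\<close>; site 0, where \<open>X\<close> is the
  identity, makes this a necessary condition.\<close>

lemma scattering_matrix_eq:
  assumes z: "z \<noteq> 0" and q: "\<And>n. cmod (q n) < 1"
    and X: "spectral_solution q z X" and X0: "X 0 = mat 1"
    and top: "((\<lambda>n. z_sigma3 z (- n) ** X n) \<longlongrightarrow> L) at_top" "L ** L' = mat 1"
    and bot: "((\<lambda>n. z_sigma3 z (- n) ** X n) \<longlongrightarrow> M) at_bot" "M ** M' = mat 1"
  shows "scattering_matrix q z = L ** M'"
proof -
  have p: "jost_plus q z = (\<lambda>n. X n ** L')"
    unfolding jost_plus_def by (rule normalised_solution_unique[OF z q X X0 top(1) _ top(2)]) simp
  have m: "jost_minus q z = (\<lambda>n. X n ** M')"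
    unfolding jost_minus_def by (rule normalised_solution_unique[OF z q X X0 bot(1) _ bot(2)]) simp
  have L'L: "L' ** L = mat 1" using top(2) matrix_left_right_inverse by blast
  show ?thesis
    unfolding scattering_matrix_def p m
  proof (rule the_equality)
    show "\<forall>n. X n ** M' = X n ** L' ** (L ** M')"
    proof
      fix n
      have "X n ** L' ** (L ** M') = X n ** ((L' ** L) ** M')"
        by (simp only: matrix_mul_assoc)
      then show "X n ** M' = X n ** L' ** (L ** M')"
        by (simp add: L'L)
    qed
  next
    fix S assume "\<forall>n. X n ** M' = X n ** L' ** S"
    then have "X 0 ** M' = X 0 ** L' ** S" by blast
    then have "M' = L' ** S" by (simp add: X0)
    then have "L ** M' = (L ** L') ** S" by (simp only: matrix_mul_assoc)
    then show "S = L ** M'" by (simp add: top(2))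
  qed
qed

lemma uniform_variation_convergent:
  assumes "uniform_variation f"
  shows "convergent (\<lambda>n. f n x)"
proof (rule Cauchy_convergent, rule metric_CauchyI)
  fix e :: real assume "e > 0"
  then have "e / 2 > 0" by simp
  then obtain N where N: "\<And>m n x. m \<ge> N \<Longrightarrow> n \<ge> N \<Longrightarrow> cmod (f m x - f n x) \<le> e / 2"
    using uniform_variation_uniformly_cauchy[OF assms] by blast
  show "\<exists>N. \<forall>m\<ge>N. \<forall>n\<ge>N. dist (f m x) (f n x) < e"
  proof (intro exI[of _ N] allI impI)
    fix m n assume "N \<le> m" "N \<le> n"
    then show "dist (f m x) (f n x) < e"
      using N[of m n x] \<open>e > 0\<close> by (simp add: dist_norm)
  qed
qed

text \<open>
  The product over the negative sites grows by multiplication on the right. Transposing it gives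
  the transfer recursion of a right half line for the reflected and conjugated potential.
\<close>

definition left_half :: "(int \<Rightarrow> complex) \<Rightarrow> nat \<Rightarrow> complex" where
  "left_half q n = cnj (q (- int n - 1))"

definition right_half :: "(int \<Rightarrow> complex) \<Rightarrow> nat \<Rightarrow> complex" where
  "right_half q n = q (int n)"

definition right_matrix :: "(int \<Rightarrow> complex) \<Rightarrow> real \<Rightarrow> nat \<Rightarrow> complex^2^2" where
  "right_matrix q \<theta> n = (let a = transfer_a (right_half q) n \<theta>; b = transfer_b (right_half q) n \<theta>
     in mat2 a (cnj b) b (cnj a))"

text \<open>The solution at -m is the inverse of the product of the step matrices at the sites -1,
  ..., -m. That product is the transpose of the transfer matrix of
  \<open>left_half q\<close>.\<close>

definition left_matrix :: "(int \<Rightarrow> complex) \<Rightarrow> real \<Rightarrow> nat \<Rightarrow> complex^2^2" where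
  "left_matrix q \<theta> n = (let a = transfer_a (left_half q) n \<theta>; b = transfer_b (left_half q) n \<theta>;
       d = of_real (transfer_det (left_half q) n)
     in mat2 (cnj a / d) (- b / d) (- cnj b / d) (a / d))"

text \<open>The solution equal to the identity at site 0, with the free evolution z^(n sigma_3)
  removed; in this form it has limits at both ends.\<close>

definition reduced_solution :: "(int \<Rightarrow> complex) \<Rightarrow> real \<Rightarrow> int \<Rightarrow> complex^2^2" where
  "reduced_solution q \<theta> n =
     (if n \<ge> 0 then right_matrix q \<theta> (nat n) else left_matrix q \<theta> (nat (- n)))"

definition int_wave :: "(int \<Rightarrow> complex) \<Rightarrow> real \<Rightarrow> int \<Rightarrow> complex" where
  "int_wave q \<theta> n = q n * cis (- (2 * of_int n + 1) * \<theta>)"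

lemma wave_right_half: "wave (right_half q) n \<theta> = int_wave q \<theta> (int n)"
  by (simp add: wave_def int_wave_def right_half_def freq_def)

text \<open>The reflection of n to -n - 1 changes the sign of 2n + 1, and together with the
  conjugation in \<open>left_half\<close> it conjugates the whole wave.\<close>

lemma wave_left_half: "cnj (wave (left_half q) n \<theta>) = int_wave q \<theta> (- int n - 1)"
  by (simp add: wave_def int_wave_def left_half_def freq_def cis_cnj algebra_simps)

text \<open>At \<open>m = 0\<close> the definition takes the right branch; the branches agree there
  because both matrices are the identity.\<close>

lemma reduced_solution_nonpos: "reduced_solution q \<theta> (- int m) = left_matrix q \<theta> m"
  by (cases "m = 0")
    (auto simp: reduced_solution_def right_matrix_def left_matrix_def transfer_a_0 transfer_b_0
      transfer_det_0)

lemma reduced_solution_step: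
  assumes q: "\<And>n. cmod (q n) < 1"
  shows "reduced_solution q \<theta> (n + 1) =
    mat2 1 (int_wave q \<theta> n) (cnj (int_wave q \<theta> n)) 1 ** reduced_solution q \<theta> n"
proof (cases "n \<ge> 0")
  case True
  then obtain m where m: "n = int m" using nonneg_int_cases by blast
  have "nat (int m + 1) = Suc m" by simp
  then show ?thesis
    unfolding m
    by (simp add: reduced_solution_def right_matrix_def Let_def mat2_mult mat2_eq_iff
        transfer_a_Suc transfer_b_Suc wave_right_half algebra_simps)
next
  case False
  \<comment> \<open>A step at a negative site leads towards 0: from \<open>left_matrix\<close> at
    \<open>Suc m\<close> to \<open>left_matrix\<close> at \<open>m\<close>, undoing the factor
    appended last.\<close>
  define m where "m = nat (- n - 1)"
  have n: "n = - int (Suc m)" "n + 1 = - int m" "n = - int m - 1" using False by (auto simp: m_def)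
  let ?a = "transfer_a (left_half q) m \<theta>" and ?b = "transfer_b (left_half q) m \<theta>"
  let ?d = "complex_of_real (transfer_det (left_half q) m)" and ?u = "int_wave q \<theta> n"
  let ?e = "1 - ?u * cnj ?u"
  have u: "?u * cnj ?u = complex_of_real ((cmod (left_half q m))\<^sup>2)"
    using complex_norm_square[of ?u] by (simp add: int_wave_def norm_mult left_half_def n(3))
  have d: "complex_of_real (transfer_det (left_half q) (Suc m)) = ?d * ?e"
    unfolding u by (simp add: transfer_det_Suc)
  have w: "wave (left_half q) m \<theta> = cnj ?u"
    using wave_left_half[of q m \<theta>] by (metis complex_cnj_cnj n(3))
  have e: "?e \<noteq> 0"
    unfolding u using q[of "- int m - 1"]
    by (metis abs_square_less_1 abs_norm_cancel complex_mod_cnj eq_iff_diff_eq_0 left_half_def less_irrefl of_real_eq_1_iff)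
  have d0: "?d \<noteq> 0"
    using transfer_det_nonzero[of "left_half q"] q by (simp add: left_half_def)
  have 1: "reduced_solution q \<theta> (n + 1) = left_matrix q \<theta> m"
    unfolding n(2) by (rule reduced_solution_nonpos)
  have 2: "reduced_solution q \<theta> n = left_matrix q \<theta> (Suc m)"
    unfolding n(1) by (rule reduced_solution_nonpos)
  show ?thesis
    unfolding 1 2 left_matrix_def Let_def d transfer_a_Suc transfer_b_Suc w mat2_mult mat2_eq_iff
    using e d0 by (simp add: divide_simps) (simp add: algebra_simps)
qed

lemma spectral_solution_reduced:
  assumes q: "\<And>n. cmod (q n) < 1"
  shows "spectral_solution q (cis \<theta>) (\<lambda>n. z_sigma3 (cis \<theta>) n ** reduced_solution q \<theta> n)"
  unfolding spectral_solution_def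
proof
  fix n
  have "z_sigma3 (cis \<theta>) (n + 1) ** mat2 1 (int_wave q \<theta> n) (cnj (int_wave q \<theta> n)) 1 =
      (z_sigma3 (cis \<theta>) 1 + potential q n) ** z_sigma3 (cis \<theta>) n"
    unfolding z_sigma3_eq potential_eq mat2_add mat2_mult mat2_eq_iff int_wave_def
    by (auto simp: cis_power_int cis_mult cis_cnj algebra_simps)
  then show "z_sigma3 (cis \<theta>) (n + 1) ** reduced_solution q \<theta> (n + 1) =
      (z_sigma3 (cis \<theta>) 1 + potential q n) ** (z_sigma3 (cis \<theta>) n ** reduced_solution q \<theta> n)"
    unfolding reduced_solution_step[OF q] by (simp only: matrix_mul_assoc)
qed

lemma z_sigma3_inverse: "z_sigma3 (cis \<theta>) (- n) ** (z_sigma3 (cis \<theta>) n ** A) = A"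
proof -
  have "z_sigma3 (cis \<theta>) (- n) ** z_sigma3 (cis \<theta>) n = mat 1"
    unfolding z_sigma3_eq mat2_mult mat2_one mat2_eq_iff by (simp add: cis_power_int cis_mult)
  then show ?thesis by (simp add: matrix_mul_assoc)
qed

text \<open>The (1,1) entry of \<open>right_matrix\<close> times the inverse of
  \<open>left_matrix\<close>, that is, a for the potential cut off to the sites from -n to n - 1;
  \<open>approx_b\<close> is the (2,1) entry.\<close>

definition approx_a :: "(int \<Rightarrow> complex) \<Rightarrow> nat \<Rightarrow> real \<Rightarrow> complex" where
  "approx_a q n \<theta> = transfer_a (right_half q) n \<theta> * transfer_a (left_half q) n \<theta> +
     cnj (transfer_b (right_half q) n \<theta>) * cnj (transfer_b (left_half q) n \<theta>)"

definition approx_b :: "(int \<Rightarrow> complex) \<Rightarrow> nat \<Rightarrow> real \<Rightarrow> complex" where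
  "approx_b q n \<theta> = transfer_b (right_half q) n \<theta> * transfer_a (left_half q) n \<theta> +
     cnj (transfer_a (right_half q) n \<theta>) * cnj (transfer_b (left_half q) n \<theta>)"

text \<open>The determinant of a product gives |a|^2 - |b|^2 as the product of the two half line
  determinants, each bounded below independently of n and \<theta>.\<close>

lemma approx_a_lower_bound:
  assumes "half_line (right_half q) j \<rho>" "half_line (left_half q) j \<rho>"
  obtains \<delta> where "\<delta> > 0" "\<And>n \<theta>. \<delta> \<le> cmod (approx_a q n \<theta>)"
proof -
  interpret R: half_line "right_half q" j \<rho> by fact
  interpret L: half_line "left_half q" j \<rho> by fact
  obtain r where r: "r > 0" "\<And>n. transfer_det (right_half q) n \<ge> r" using R.transfer_det_lower by blast
  obtain l where l: "l > 0" "\<And>n. transfer_det (left_half q) n \<ge> l" using L.transfer_det_lower by blast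
  have "r * l \<le> (cmod (approx_a q n \<theta>))\<^sup>2" for n \<theta>
  proof -
    let ?a = "transfer_a (right_half q) n \<theta>" and ?b = "transfer_b (right_half q) n \<theta>"
    let ?c = "transfer_a (left_half q) n \<theta>" and ?d = "transfer_b (left_half q) n \<theta>"
    have "approx_a q n \<theta> * cnj (approx_a q n \<theta>) - approx_b q n \<theta> * cnj (approx_b q n \<theta>) =
        (?a * cnj ?a - ?b * cnj ?b) * (?c * cnj ?c - ?d * cnj ?d)"
      by (simp add: approx_a_def approx_b_def algebra_simps)
    then have "complex_of_real ((cmod (approx_a q n \<theta>))\<^sup>2 - (cmod (approx_b q n \<theta>))\<^sup>2) =
        complex_of_real (transfer_det (right_half q) n * transfer_det (left_half q) n)"
      by (simp only: transfer_determinant of_real_diff of_real_mult complex_norm_square)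
    then have "(cmod (approx_a q n \<theta>))\<^sup>2 - (cmod (approx_b q n \<theta>))\<^sup>2 =
        transfer_det (right_half q) n * transfer_det (left_half q) n"
      using of_real_eq_iff by blast
    moreover have "r * l \<le> transfer_det (right_half q) n * transfer_det (left_half q) n"
      using r l by (intro mult_mono) (auto intro: order_trans[OF less_imp_le])
    ultimately show ?thesis using zero_le_power2[of "cmod (approx_b q n \<theta>)"] by linarith
  qed
  then have "sqrt (r * l) \<le> cmod (approx_a q n \<theta>)" for n \<theta>
    by (simp add: real_le_lsqrt)
  moreover have "sqrt (r * l) > 0" using r l by simp
  ultimately show ?thesis using that by blast
qed

lemma reflection_coeff_limit:
  assumes hR: "half_line (right_half q) j \<rho>" and hL: "half_line (left_half q) j \<rho>"
  shows "(\<lambda>n. approx_b q n \<theta> / approx_a q n \<theta>) \<longlonglongrightarrow> reflection_coeff q \<theta>"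
proof -
  interpret R: half_line "right_half q" j \<rho> by fact
  interpret L: half_line "left_half q" j \<rho> by fact
  have q: "cmod (q n) < 1" for n
  proof (cases "n \<ge> 0")
    case True
    then show ?thesis using R.p_less_1[of "nat n"] by (simp add: right_half_def)
  next
    case False
    then show ?thesis using L.p_less_1[of "nat (- n - 1)"] by (simp add: left_half_def)
  qed
  obtain a where a: "(\<lambda>n. transfer_a (right_half q) n \<theta>) \<longlonglongrightarrow> a"
    using uniform_variation_convergent[OF R.uniform_variation_transfer(1)] unfolding convergent_def by blast
  obtain b where b: "(\<lambda>n. transfer_b (right_half q) n \<theta>) \<longlonglongrightarrow> b"
    using uniform_variation_convergent[OF R.uniform_variation_transfer(2)] unfolding convergent_def by blast
  obtain c where c: "(\<lambda>n. transfer_a (left_half q) n \<theta>) \<longlonglongrightarrow> c"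
    using uniform_variation_convergent[OF L.uniform_variation_transfer(1)] unfolding convergent_def by blast
  obtain d where d: "(\<lambda>n. transfer_b (left_half q) n \<theta>) \<longlonglongrightarrow> d"
    using uniform_variation_convergent[OF L.uniform_variation_transfer(2)] unfolding convergent_def by blast
  have det: "(\<lambda>n. complex_of_real (transfer_det p n)) \<longlonglongrightarrow> x * cnj x - y * cnj y"
    if "(\<lambda>n. transfer_a p n \<theta>) \<longlonglongrightarrow> x" "(\<lambda>n. transfer_b p n \<theta>) \<longlonglongrightarrow> y" for p x y
    unfolding transfer_determinant[of p _ \<theta>, symmetric]
    by (intro tendsto_intros that)
  \<comment> \<open>A limit of nonzero determinants could still vanish; their uniform lower bound
    excludes this.\<close>
  have nz: "x * cnj x - y * cnj y \<noteq> 0"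
    if h: "half_line p j \<rho>" and lim: "(\<lambda>n. transfer_a p n \<theta>) \<longlonglongrightarrow> x" "(\<lambda>n. transfer_b p n \<theta>) \<longlonglongrightarrow> y"
    for p x y
  proof -
    obtain \<delta> where \<delta>: "\<delta> > 0" "\<And>n. transfer_det p n \<ge> \<delta>"
      using half_line.transfer_det_lower[OF h] by blast
    have "(\<lambda>n. cmod (complex_of_real (transfer_det p n))) \<longlonglongrightarrow> cmod (x * cnj x - y * cnj y)"
      by (intro tendsto_norm det lim)
    moreover have "\<delta> \<le> cmod (complex_of_real (transfer_det p n))" for n
      using order_trans[OF \<delta>(2)[of n] abs_ge_self] by simp
    ultimately have "\<delta> \<le> cmod (x * cnj x - y * cnj y)"
      by (intro LIMSEQ_le_const) auto
    then show ?thesis using \<delta>(1) by auto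
  qed
  let ?D = "c * cnj c - d * cnj d" and ?E = "a * cnj a - b * cnj b"
  have D: "?D \<noteq> 0" and E: "?E \<noteq> 0" using nz[OF hL c d] nz[OF hR a b] .
  \<comment> \<open>The limits at the two ends and their inverses. \<open>Lm'\<close> has no
    denominators because \<open>left_matrix\<close> is already an inverse.\<close>
  define Lp where "Lp = mat2 a (cnj b) b (cnj a)"
  define Lp' where "Lp' = mat2 (cnj a / ?E) (- cnj b / ?E) (- b / ?E) (a / ?E)"
  define Lm where "Lm = mat2 (cnj c / ?D) (- d / ?D) (- cnj d / ?D) (c / ?D)"
  define Lm' where "Lm' = mat2 c d (cnj d) (cnj c)"
  let ?X = "\<lambda>n. z_sigma3 (cis \<theta>) n ** reduced_solution q \<theta> n"
  have inv: "Lp ** Lp' = mat 1" "Lm ** Lm' = mat 1"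
    using D E unfolding Lp_def Lp'_def Lm_def Lm'_def mat2_mult mat2_one mat2_eq_iff
    by (auto simp: divide_simps)
  have "right_matrix q \<theta> \<longlonglongrightarrow> Lp"
    unfolding right_matrix_def[abs_def] Lp_def Let_def by (intro tendsto_mat2 tendsto_cnj a b)
  then have "((\<lambda>n. right_matrix q \<theta> (nat n)) \<longlongrightarrow> Lp) at_top"
    by (rule filterlim_compose[OF _ filterlim_nat_sequentially])
  moreover have "\<forall>\<^sub>F n in at_top. right_matrix q \<theta> (nat n) = reduced_solution q \<theta> n"
    using eventually_ge_at_top[of 0] by eventually_elim (simp add: reduced_solution_def)
  ultimately have top: "(reduced_solution q \<theta> \<longlongrightarrow> Lp) at_top"
    by (rule Lim_transform_eventually)
  have "left_matrix q \<theta> \<longlonglongrightarrow> Lm"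
    unfolding left_matrix_def[abs_def] Lm_def Let_def
    by (intro tendsto_mat2 tendsto_divide tendsto_minus tendsto_cnj c d det D)
  then have "((\<lambda>n. left_matrix q \<theta> (nat n)) \<longlongrightarrow> Lm) at_top"
    by (rule filterlim_compose[OF _ filterlim_nat_sequentially])
  moreover have "\<forall>\<^sub>F n in at_top. left_matrix q \<theta> (nat n) = reduced_solution q \<theta> (- n)"
    using eventually_ge_at_top[of 0]
    by eventually_elim (metis int_nat_eq reduced_solution_nonpos)
  ultimately have "((\<lambda>n. reduced_solution q \<theta> (- n)) \<longlongrightarrow> Lm) at_top"
    by (rule Lim_transform_eventually)
  then have bot: "(reduced_solution q \<theta> \<longlongrightarrow> Lm) at_bot"
    unfolding at_bot_mirror by (simp add: filterlim_filtermap)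
  have X0: "?X 0 = mat 1"
    by (simp add: reduced_solution_def right_matrix_def transfer_a_0 transfer_b_0 z_sigma3_eq mat2_one mat2_mult)
  have "scattering_matrix q (cis \<theta>) = Lp ** Lm'"
    by (rule scattering_matrix_eq[OF _ q spectral_solution_reduced[OF q] X0 _ inv(1) _ inv(2)])
      (simp_all add: z_sigma3_inverse top bot)
  then have S: "scattering_a q (cis \<theta>) = a * c + cnj b * cnj d" "scattering_b q (cis \<theta>) = b * c + cnj a * cnj d"
    by (simp_all add: scattering_a_def scattering_b_def Lp_def Lm'_def mat2_mult)
  have la: "(\<lambda>n. approx_a q n \<theta>) \<longlonglongrightarrow> scattering_a q (cis \<theta>)"
    unfolding approx_a_def S by (intro tendsto_intros a b c d)
  have lb: "(\<lambda>n. approx_b q n \<theta>) \<longlonglongrightarrow> scattering_b q (cis \<theta>)"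
    unfolding approx_b_def S by (intro tendsto_intros a b c d)
  obtain \<delta> where \<delta>: "\<delta> > 0" "\<And>n \<theta>. \<delta> \<le> cmod (approx_a q n \<theta>)"
    using approx_a_lower_bound[OF hR hL] by blast
  have "\<delta> \<le> cmod (scattering_a q (cis \<theta>))"
    by (rule LIMSEQ_le_const[OF tendsto_norm[OF la]]) (use \<delta> in auto)
  then have "scattering_a q (cis \<theta>) \<noteq> 0" using \<delta>(1) by auto
  then show ?thesis unfolding reflection_coeff_def by (intro tendsto_divide la lb)
qed

section \<open>Passage to the limit\<close>

lemma measurable_continuous_circle:
  fixes f :: "real \<Rightarrow> complex"
  shows "continuous_on UNIV f \<Longrightarrow> f \<in> borel_measurable circle_measure"
  by (intro borel_measurable_integrable integrable_circle)

lemma integrable_mult_L2: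
  assumes "g \<in> L2_circle" "continuous_on UNIV f"
  shows "integrable circle_measure (\<lambda>x. g x * f x)"
proof (rule Bochner_Integration.integrable_bound)
  have "integrable circle_measure (\<lambda>x. (cmod (f x))\<^sup>2)"
    by (intro integrable_circle continuous_on_power continuous_on_norm assms)
  then show "integrable circle_measure (\<lambda>x. (cmod (g x))\<^sup>2 + (cmod (f x))\<^sup>2)"
    using assms by (intro Bochner_Integration.integrable_add) (auto simp: L2_circle_def)
  show "(\<lambda>x. g x * f x) \<in> borel_measurable circle_measure"
    using assms measurable_continuous_circle by (intro borel_measurable_times) (auto simp: L2_circle_def)
  show "AE x in circle_measure. norm (g x * f x) \<le> norm ((cmod (g x))\<^sup>2 + (cmod (f x))\<^sup>2)"
  proof (rule AE_I2)
    fix x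
    have "cmod (g x) * cmod (f x) \<ge> 0" by simp
    then have "cmod (g x) * cmod (f x) \<le> (cmod (g x))\<^sup>2 + (cmod (f x))\<^sup>2"
      using sum_squares_bound[of "cmod (g x)" "cmod (f x)"] by linarith
    then show "norm (g x * f x) \<le> norm ((cmod (g x))\<^sup>2 + (cmod (f x))\<^sup>2)"
      by (simp add: norm_mult)
  qed
qed

text \<open>Integrated with a suitable \<eta>, this takes the place of the Cauchy-Schwarz inequality
  for integrals.\<close>

lemma young_square:
  fixes u v \<eta> :: real
  assumes "u \<ge> 0" "v \<ge> 0" and \<eta>: "\<eta> > 0"
  shows "u * v \<le> u\<^sup>2 / \<eta> + \<eta> * v\<^sup>2"
proof -
  have "2 * (u / sqrt \<eta>) * (sqrt \<eta> * v) \<le> (u / sqrt \<eta>)\<^sup>2 + (sqrt \<eta> * v)\<^sup>2"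
    by (rule sum_squares_bound)
  then have "2 * (u * v) \<le> u\<^sup>2 / \<eta> + \<eta> * v\<^sup>2"
    using \<eta> by (simp add: power_divide power_mult_distrib)
  moreover have "u * v \<ge> 0" using assms by simp
  ultimately show ?thesis by linarith
qed

text \<open>Prepares the extraction of an almost everywhere convergent subsequence, which starts
  from L1 control; the circle has finite length.\<close>

lemma L2_cauchy_imp_L1_cauchy:
  assumes "L2_cauchy f" "e > 0"
  shows "\<exists>N. \<forall>i\<ge>N. \<forall>j\<ge>N. integral\<^sup>L circle_measure (\<lambda>x. cmod (f i x - f j x)) < e"
proof -
  \<comment> \<open>Makes the constant term \<open>2 * pi * \<eta>\<close> equal to
    \<open>e / 2\<close>; the energy bound \<open>\<eta> * (e / 2)\<close> accounts for the other
    half.\<close>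
  define \<eta> where "\<eta> = e / (4 * pi)"
  have \<eta>: "\<eta> > 0" using assms(2) by (simp add: \<eta>_def)
  have cp: "continuous_periodic (f n)" for n using assms(1) by (simp add: L2_cauchy_def)
  have "\<eta> * (e / 2) > 0" using \<eta> assms(2) by simp
  then obtain N where N: "\<forall>m\<ge>N. \<forall>n\<ge>N. energy (\<lambda>x. f m x - f n x) < \<eta> * (e / 2)"
    using assms(1) unfolding L2_cauchy_def by blast
  show ?thesis
  proof (intro exI[of _ N] allI impI)
    fix i j assume ij: "N \<le> i" "N \<le> j"
    have cd: "continuous_periodic (\<lambda>x. f i x - f j x)" by (intro continuous_periodic_diff cp)
    have int: "integrable circle_measure (\<lambda>x. cmod (f i x - f j x))"
      using cd unfolding continuous_periodic_def by (intro integrable_circle continuous_on_norm) auto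
    have "integral\<^sup>L circle_measure (\<lambda>x. cmod (f i x - f j x)) \<le>
        integral\<^sup>L circle_measure (\<lambda>x. (cmod (f i x - f j x))\<^sup>2 / \<eta> + \<eta>)"
    proof (rule integral_mono[OF int])
      show "integrable circle_measure (\<lambda>x. (cmod (f i x - f j x))\<^sup>2 / \<eta> + \<eta>)"
        by (intro Bochner_Integration.integrable_add integrable_divide integrable_energy[OF cd] integrable_circle) simp
      show "cmod (f i x - f j x) \<le> (cmod (f i x - f j x))\<^sup>2 / \<eta> + \<eta>" for x
        using young_square[of "cmod (f i x - f j x)" 1 \<eta>] \<eta> by simp
    qed
    also have "\<dots> = energy (\<lambda>x. f i x - f j x) / \<eta> + 2 * pi * \<eta>"
      unfolding energy_def integral_const_circle[symmetric]
      by (subst Bochner_Integration.integral_add)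
        (simp_all only: integral_divide_zero integrable_divide integrable_energy[OF cd] integrable_circle continuous_on_const)
    also have "\<dots> < e"
    proof -
      have "energy (\<lambda>x. f i x - f j x) / \<eta> < e / 2"
        using N[rule_format, OF ij] \<eta> by (simp add: divide_less_eq mult.commute)
      moreover have "2 * pi * \<eta> = e / 2" by (simp add: \<eta>_def)
      ultimately show ?thesis by linarith
    qed
    finally show "integral\<^sup>L circle_measure (\<lambda>x. cmod (f i x - f j x)) < e" .
  qed
qed

text \<open>Riesz-Fischer: the limit is taken along an almost everywhere convergent subsequence, and
  Fatou's lemma brings the whole sequence close to it.\<close>

lemma L2_complete:
  assumes f: "L2_cauchy f"
  shows "\<exists>g\<in>L2_circle. \<forall>e>0. \<exists>N. \<forall>n\<ge>N. integrable circle_measure (\<lambda>x. (cmod (f n x - g x))\<^sup>2) \<and>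
      integral\<^sup>L circle_measure (\<lambda>x. (cmod (f n x - g x))\<^sup>2) \<le> e"
proof -
  have cp: "continuous_periodic (f n)" for n using f by (simp add: L2_cauchy_def)
  then have int: "integrable circle_measure (f n)" for n
    unfolding continuous_periodic_def by (intro integrable_circle) blast
  then have [measurable]: "f n \<in> borel_measurable circle_measure" for n by (rule borel_measurable_integrable)
  obtain r where r: "strict_mono r" "AE x in circle_measure. Cauchy (\<lambda>i. f (r i) x)"
    using cauchy_L1_AE_cauchy_subseq[OF int L2_cauchy_imp_L1_cauchy[OF f]] by metis
  \<comment> \<open>On the null set where the subsequence diverges this is an unspecified
    value.\<close>
  define g where "g x = lim (\<lambda>i. f (r i) x)" for x
  have g [measurable]: "g \<in> borel_measurable circle_measure"
    unfolding g_def[abs_def] by measurable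
  have lim: "AE x in circle_measure. (\<lambda>i. f (r i) x) \<longlonglongrightarrow> g x"
    using r(2) by eventually_elim (simp add: g_def Cauchy_convergent_iff convergent_LIMSEQ_iff)
  have close: "\<exists>N. \<forall>n\<ge>N. integrable circle_measure (\<lambda>x. (cmod (f n x - g x))\<^sup>2) \<and>
      integral\<^sup>L circle_measure (\<lambda>x. (cmod (f n x - g x))\<^sup>2) \<le> e" if e: "e > 0" for e
  proof -
    obtain N where N: "\<forall>m\<ge>N. \<forall>n\<ge>N. energy (\<lambda>x. f m x - f n x) < e"
      using f e unfolding L2_cauchy_def by blast
    have "integrable circle_measure (\<lambda>x. (cmod (f n x - g x))\<^sup>2) \<and>
      integral\<^sup>L circle_measure (\<lambda>x. (cmod (f n x - g x))\<^sup>2) \<le> e" if n: "n \<ge> N" for n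
    proof -
      \<comment> \<open>Fatou with \<open>n\<close> fixed and the second index running along the
        subsequence turns the Cauchy estimate into one for the limit.\<close>
      have "AE x in circle_measure. ennreal ((cmod (f n x - g x))\<^sup>2) =
          liminf (\<lambda>i. ennreal ((cmod (f n x - f (r i) x))\<^sup>2))"
        using lim
      proof eventually_elim
        case (elim x)
        have "(\<lambda>i. ennreal ((cmod (f n x - f (r i) x))\<^sup>2)) \<longlonglongrightarrow> ennreal ((cmod (f n x - g x))\<^sup>2)"
          by (intro tendsto_ennrealI tendsto_intros elim)
        from lim_imp_Liminf[OF trivial_limit_sequentially this] show ?case by (rule sym)
      qed
      then have "(\<integral>\<^sup>+ x. ennreal ((cmod (f n x - g x))\<^sup>2) \<partial>circle_measure) =
          (\<integral>\<^sup>+ x. liminf (\<lambda>i. ennreal ((cmod (f n x - f (r i) x))\<^sup>2)) \<partial>circle_measure)"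
        by (rule nn_integral_cong_AE)
      also have "\<dots> \<le> liminf (\<lambda>i. \<integral>\<^sup>+ x. ennreal ((cmod (f n x - f (r i) x))\<^sup>2) \<partial>circle_measure)"
        by (rule nn_integral_liminf) measurable
      also have "\<dots> \<le> limsup (\<lambda>i. \<integral>\<^sup>+ x. ennreal ((cmod (f n x - f (r i) x))\<^sup>2) \<partial>circle_measure)"
        by (rule Liminf_le_Limsup) simp
      also have "\<dots> \<le> ennreal e"
      proof (rule Limsup_bounded)
        show "\<forall>\<^sub>F i in sequentially. (\<integral>\<^sup>+ x. ennreal ((cmod (f n x - f (r i) x))\<^sup>2) \<partial>circle_measure) \<le> ennreal e"
          using eventually_ge_at_top[of N]
        proof eventually_elim
          case (elim i)
          then have "r i \<ge> N" using seq_suble[OF r(1), of i] by linarith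
          then have "energy (\<lambda>x. f n x - f (r i) x) \<le> e" using N n by (simp add: less_imp_le)
          moreover have "(\<integral>\<^sup>+ x. ennreal ((cmod (f n x - f (r i) x))\<^sup>2) \<partial>circle_measure) =
              ennreal (energy (\<lambda>x. f n x - f (r i) x))"
            unfolding energy_def
            by (rule nn_integral_eq_integral) (simp_all add: integrable_energy continuous_periodic_diff cp)
          ultimately show ?case by (simp add: ennreal_leI)
        qed
      qed
      finally have le: "(\<integral>\<^sup>+ x. ennreal ((cmod (f n x - g x))\<^sup>2) \<partial>circle_measure) \<le> ennreal e" .
      have i: "integrable circle_measure (\<lambda>x. (cmod (f n x - g x))\<^sup>2)"
      proof (rule integrableI_bounded)
        show "(\<integral>\<^sup>+ x. ennreal (norm ((cmod (f n x - g x))\<^sup>2)) \<partial>circle_measure) < \<infinity>"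
          using le_less_trans[OF le ennreal_less_top] by simp
      qed measurable
      moreover have "integral\<^sup>L circle_measure (\<lambda>x. (cmod (f n x - g x))\<^sup>2) \<le> e"
        using le nn_integral_eq_integral[OF i] e by (simp add: ennreal_le_iff)
      ultimately show ?thesis by blast
    qed
    then show ?thesis by blast
  qed
  have "g \<in> L2_circle"
  proof -
    \<comment> \<open>One index is enough: \<open>g\<close> differs from the square integrable
      \<open>f n\<close> by a square integrable function.\<close>
    obtain n where n: "integrable circle_measure (\<lambda>x. (cmod (f n x - g x))\<^sup>2)"
      using close[of 1] by auto
    have "integrable circle_measure (\<lambda>x. (cmod (g x))\<^sup>2)"
    proof (rule Bochner_Integration.integrable_bound)
      show "integrable circle_measure (\<lambda>x. 2 * (cmod (f n x - g x))\<^sup>2 + 2 * (cmod (f n x))\<^sup>2)"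
        by (intro Bochner_Integration.integrable_add integrable_mult_right n integrable_energy cp)
      show "AE x in circle_measure. norm ((cmod (g x))\<^sup>2) \<le>
          norm (2 * (cmod (f n x - g x))\<^sup>2 + 2 * (cmod (f n x))\<^sup>2)"
      proof (rule AE_I2)
        fix x
        have "cmod (g x) \<le> cmod (f n x - g x) + cmod (f n x)"
          by (metis add.commute norm_minus_commute norm_triangle_sub)
        then have "(cmod (g x))\<^sup>2 \<le> (cmod (f n x - g x) + cmod (f n x))\<^sup>2"
          by (intro power_mono) auto
        also have "\<dots> \<le> 2 * (cmod (f n x - g x))\<^sup>2 + 2 * (cmod (f n x))\<^sup>2"
          using sum_squares_bound[of "cmod (f n x - g x)" "cmod (f n x)"] by (simp add: power2_sum)
        finally show "norm ((cmod (g x))\<^sup>2) \<le> norm (2 * (cmod (f n x - g x))\<^sup>2 + 2 * (cmod (f n x))\<^sup>2)"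
          by simp
      qed
    qed measurable
    then show ?thesis using g by (simp add: L2_circle_def)
  qed
  then show ?thesis using close by blast
qed

lemma L2_limit_integral:
  assumes h: "L2_cauchy h" and g: "g \<in> L2_circle"
    and lim: "\<forall>e>0. \<exists>N. \<forall>n\<ge>N. integrable circle_measure (\<lambda>x. (cmod (h n x - g x))\<^sup>2) \<and>
      integral\<^sup>L circle_measure (\<lambda>x. (cmod (h n x - g x))\<^sup>2) \<le> e"
    and \<phi>: "continuous_periodic \<phi>"
  shows "(\<lambda>n. integral\<^sup>L circle_measure (\<lambda>x. h n x * \<phi> x)) \<longlonglongrightarrow> integral\<^sup>L circle_measure (\<lambda>x. g x * \<phi> x)"
proof (rule metric_LIMSEQ_I)
  fix e :: real assume e: "e > 0"
  have ch: "continuous_on UNIV (h n)" for n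
    using h by (simp add: L2_cauchy_def continuous_periodic_def)
  have c\<phi>: "continuous_on UNIV \<phi>" using \<phi> by (simp add: continuous_periodic_def)
  \<comment> \<open>Makes the term with \<phi> smaller than \<open>e / 2\<close>; adding 1 covers
    the case of zero energy.\<close>
  define \<eta> where "\<eta> = e / (2 * (energy \<phi> + 1))"
  have \<eta>: "\<eta> > 0" "\<eta> * energy \<phi> < e / 2"
    using e energy_nonneg[of \<phi>] by (auto simp: \<eta>_def field_simps)
  have "\<eta> * (e / 2) > 0" using \<eta> e by simp
  then obtain N where N: "\<forall>n\<ge>N. integrable circle_measure (\<lambda>x. (cmod (h n x - g x))\<^sup>2) \<and>
      integral\<^sup>L circle_measure (\<lambda>x. (cmod (h n x - g x))\<^sup>2) \<le> \<eta> * (e / 2)"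
    using lim by blast
  show "\<exists>N. \<forall>n\<ge>N. dist (integral\<^sup>L circle_measure (\<lambda>x. h n x * \<phi> x))
      (integral\<^sup>L circle_measure (\<lambda>x. g x * \<phi> x)) < e"
  proof (intro exI[of _ N] allI impI)
    fix n assume "N \<le> n"
    then have n: "integrable circle_measure (\<lambda>x. (cmod (h n x - g x))\<^sup>2)"
      "integral\<^sup>L circle_measure (\<lambda>x. (cmod (h n x - g x))\<^sup>2) \<le> \<eta> * (e / 2)"
      using N by blast+
    have i1: "integrable circle_measure (\<lambda>x. h n x * \<phi> x)"
      by (intro integrable_circle continuous_on_mult ch c\<phi>)
    have i2: "integrable circle_measure (\<lambda>x. g x * \<phi> x)"
      by (rule integrable_mult_L2[OF g c\<phi>])
    have "integral\<^sup>L circle_measure (\<lambda>x. h n x * \<phi> x) - integral\<^sup>L circle_measure (\<lambda>x. g x * \<phi> x) =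
        integral\<^sup>L circle_measure (\<lambda>x. h n x * \<phi> x - g x * \<phi> x)"
      by (rule Bochner_Integration.integral_diff[OF i1 i2, symmetric])
    then have "dist (integral\<^sup>L circle_measure (\<lambda>x. h n x * \<phi> x))
        (integral\<^sup>L circle_measure (\<lambda>x. g x * \<phi> x)) = norm (integral\<^sup>L circle_measure (\<lambda>x. h n x * \<phi> x - g x * \<phi> x))"
      by (simp add: dist_norm)
    also have "\<dots> \<le> integral\<^sup>L circle_measure (\<lambda>x. norm (h n x * \<phi> x - g x * \<phi> x))"
      by (rule integral_norm_bound)
    also have "\<dots> \<le> integral\<^sup>L circle_measure (\<lambda>x. (cmod (h n x - g x))\<^sup>2 / \<eta> + \<eta> * (cmod (\<phi> x))\<^sup>2)"
    proof (rule integral_mono)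
      show "integrable circle_measure (\<lambda>x. norm (h n x * \<phi> x - g x * \<phi> x))"
        by (intro integrable_norm Bochner_Integration.integrable_diff i1 i2)
      show "integrable circle_measure (\<lambda>x. (cmod (h n x - g x))\<^sup>2 / \<eta> + \<eta> * (cmod (\<phi> x))\<^sup>2)"
        by (intro Bochner_Integration.integrable_add integrable_divide integrable_mult_right n integrable_energy \<phi>)
      show "norm (h n x * \<phi> x - g x * \<phi> x) \<le> (cmod (h n x - g x))\<^sup>2 / \<eta> + \<eta> * (cmod (\<phi> x))\<^sup>2" for x
        using young_square[of "cmod (h n x - g x)" "cmod (\<phi> x)" \<eta>] \<eta>(1)
        by (simp add: norm_mult[symmetric] left_diff_distrib)
    qed
    also have "\<dots> = integral\<^sup>L circle_measure (\<lambda>x. (cmod (h n x - g x))\<^sup>2) / \<eta> + \<eta> * energy \<phi>"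
      unfolding energy_def
      by (simp add: n(1) integrable_energy[OF \<phi>])
    also have "\<dots> < e"
    proof -
      have "integral\<^sup>L circle_measure (\<lambda>x. (cmod (h n x - g x))\<^sup>2) / \<eta> \<le> e / 2"
        using n(2) \<eta>(1) by (simp add: divide_le_eq mult.commute)
      then show ?thesis using \<eta>(2) by linarith
    qed
    finally show "dist (integral\<^sup>L circle_measure (\<lambda>x. h n x * \<phi> x))
      (integral\<^sup>L circle_measure (\<lambda>x. g x * \<phi> x)) < e" .
  qed
qed

section \<open>Test functions and weak derivatives\<close>

lemma nth_vector_derivative_0: "nth_vector_derivative 0 \<phi> = \<phi>"
  by (simp add: nth_vector_derivative_def)

lemma has_vector_derivative_nth:
  assumes "\<phi> \<in> smooth_periodic"
  shows "(nth_vector_derivative m \<phi> has_vector_derivative nth_vector_derivative (Suc m) \<phi> x) (at x)"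
  using assms unfolding smooth_periodic_def
  by (simp add: nth_vector_derivative_def vector_derivative_works[symmetric])

text \<open>\<open>smooth_periodic\<close> demands periodicity only at order 0; differentiating the
  shifted function passes it on to the next order.\<close>

lemma continuous_periodic_nth_vector_derivative:
  assumes "\<phi> \<in> smooth_periodic"
  shows "continuous_periodic (nth_vector_derivative m \<phi>)"
proof (induction m)
  case 0
  have "continuous_on UNIV (nth_vector_derivative 0 \<phi>)"
    using has_vector_derivative_continuous[OF has_vector_derivative_nth[OF assms]]
    by (simp add: continuous_at_imp_continuous_on)
  then show ?case
    using assms by (simp add: continuous_periodic_def smooth_periodic_def nth_vector_derivative_0)
next
  case (Suc m)
  have "continuous_on UNIV (nth_vector_derivative (Suc m) \<phi>)"
    using has_vector_derivative_continuous[OF has_vector_derivative_nth[OF assms]]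
    by (simp add: continuous_at_imp_continuous_on)
  moreover have "nth_vector_derivative (Suc m) \<phi> (x + 2 * pi) = nth_vector_derivative (Suc m) \<phi> x" for x
  proof -
    have "((\<lambda>y. y + 2 * pi) has_vector_derivative 1) (at x)"
      by (auto intro!: derivative_eq_intros)
    then have "((nth_vector_derivative m \<phi> \<circ> (\<lambda>y. y + 2 * pi)) has_vector_derivative
        1 *\<^sub>R nth_vector_derivative (Suc m) \<phi> (x + 2 * pi)) (at x)"
      by (rule vector_diff_chain_at) (rule has_vector_derivative_nth[OF assms])
    moreover have "nth_vector_derivative m \<phi> \<circ> (\<lambda>y. y + 2 * pi) = nth_vector_derivative m \<phi>"
      using Suc by (auto simp: continuous_periodic_def)
    ultimately show ?thesis
      using has_vector_derivative_nth[OF assms, of m x] vector_derivative_unique_at by fastforce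
  qed
  ultimately show ?case by (simp add: continuous_periodic_def)
qed

lemma L2_class_imp_L2_cauchy: "L2_class k f \<Longrightarrow> L2_cauchy f"
  by (cases k) (auto intro: uniform_variation_imp_L2_cauchy)

lemma circle_integration_by_parts:
  assumes f: "continuous_periodic f" "continuous_periodic f'"
      "\<And>x. (f has_vector_derivative f' x) (at x)"
    and g: "continuous_periodic g" "continuous_periodic g'"
      "\<And>x. (g has_vector_derivative g' x) (at x)"
  shows "integral\<^sup>L circle_measure (\<lambda>x. f x * g' x) = - integral\<^sup>L circle_measure (\<lambda>x. f' x * g x)"
proof -
  have i: "integrable circle_measure (\<lambda>x. f x * g' x)" "integrable circle_measure (\<lambda>x. f' x * g x)"
    using f g unfolding continuous_periodic_def by (auto intro!: integrable_circle continuous_on_mult)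
  have "((\<lambda>x. f x * g' x + f' x * g x) has_integral (f pi * g pi - f (- pi) * g (- pi))) {-pi..pi}"
    using has_vector_derivative_at_within[OF has_vector_derivative_mult[OF f(3) g(3)]]
    by (intro fundamental_theorem_of_calculus) auto
  moreover have "f pi = f (- pi)" "g pi = g (- pi)"
    using f(1) g(1) spec[of "\<lambda>x. f (x + 2 * pi) = f x" "- pi"] spec[of "\<lambda>x. g (x + 2 * pi) = g x" "- pi"]
    by (auto simp: continuous_periodic_def)
  ultimately have "integral {-pi..pi} (\<lambda>x. f x * g' x + f' x * g x) = 0"
    by (simp add: integral_unique)
  then have "integral\<^sup>L circle_measure (\<lambda>x. f x * g' x + f' x * g x) = 0"
    using lebesgue_integral_eq_integral[OF Bochner_Integration.integrable_add[OF i]] by simp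
  then show ?thesis
    using i by (simp add: eq_neg_iff_add_eq_0)
qed

text \<open>\<open>h\<close> is the sequence of classical derivatives of order \<alpha>; each
  integration by parts moves one derivative and contributes one sign.\<close>

lemma L2_class_weak_derivative:
  "L2_class k f \<Longrightarrow> \<alpha> \<le> k \<Longrightarrow> \<exists>h. L2_cauchy h \<and> (\<forall>\<phi>\<in>smooth_periodic. \<forall>n.
    integral\<^sup>L circle_measure (\<lambda>\<theta>. f n \<theta> * nth_vector_derivative \<alpha> \<phi> \<theta>) =
    (-1) ^ \<alpha> * integral\<^sup>L circle_measure (\<lambda>\<theta>. h n \<theta> * \<phi> \<theta>))"
proof (induction \<alpha> arbitrary: k f)
  case 0
  then show ?case
    using L2_class_imp_L2_cauchy by (intro exI[of _ f]) (simp add: nth_vector_derivative_0)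
next
  case (Suc \<alpha>)
  then obtain j where j: "k = Suc j" by (cases k) auto
  obtain f' where f: "uniform_variation f" "\<And>n x. (f n has_vector_derivative f' n x) (at x)" "L2_class j f'"
    using deriv_class_SucE[OF Suc.prems(1)[unfolded j]] by blast
  obtain h where h: "L2_cauchy h" "\<forall>\<phi>\<in>smooth_periodic. \<forall>n.
    integral\<^sup>L circle_measure (\<lambda>\<theta>. f' n \<theta> * nth_vector_derivative \<alpha> \<phi> \<theta>) =
    (-1) ^ \<alpha> * integral\<^sup>L circle_measure (\<lambda>\<theta>. h n \<theta> * \<phi> \<theta>)"
    using Suc.IH[OF f(3)] Suc.prems(2) j by auto
  have c: "continuous_periodic (f n)" "continuous_periodic (f' n)" for n
    using f(1) L2_class_imp_L2_cauchy[OF f(3)] by (simp_all add: uniform_variation_def L2_cauchy_def)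
  have "integral\<^sup>L circle_measure (\<lambda>\<theta>. f n \<theta> * nth_vector_derivative (Suc \<alpha>) \<phi> \<theta>) =
      - integral\<^sup>L circle_measure (\<lambda>\<theta>. f' n \<theta> * nth_vector_derivative \<alpha> \<phi> \<theta>)"
    if "\<phi> \<in> smooth_periodic" for n \<phi>
    by (intro circle_integration_by_parts c f(2) has_vector_derivative_nth
        continuous_periodic_nth_vector_derivative that)
  then show ?case using h by (intro exI[of _ h]) simp
qed

text \<open>The two sides of the weak identity pass to the limit differently: dominated convergence
  for \<open>F\<close>, which is given as a pointwise limit, and mean square convergence for the
  derivatives.\<close>

lemma L2_class_limit_in_sobolev:
  assumes f: "L2_class k f" and k: "k \<ge> 1" and lim: "\<And>\<theta>. (\<lambda>n. f n \<theta>) \<longlonglongrightarrow> F \<theta>"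
  shows "F \<in> sobolev_circle k"
proof -
  obtain j where j: "k = Suc j" using k by (cases k) auto
  \<comment> \<open>\<open>k \<ge> 1\<close> puts order zero on the uniform side, which yields a
    bound \<open>K\<close> common to all \<open>f n\<close> and hence to \<open>F\<close>.\<close>
  have uv: "uniform_variation f" using f by (simp add: j)
  obtain K where K: "\<And>n. continuous_periodic (f n)" "\<And>n x. cmod (f n x) \<le> K"
    using uniform_variationE[OF uv] by metis
  have cf: "continuous_on UNIV (f n)" for n using K(1) by (simp add: continuous_periodic_def)
  have mf [measurable]: "f n \<in> borel_measurable circle_measure" for n
    by (rule measurable_continuous_circle[OF cf])
  have mF [measurable]: "F \<in> borel_measurable circle_measure"
    by (rule borel_measurable_LIMSEQ_metric[OF mf lim])
  have FK: "cmod (F x) \<le> K" for x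
    by (rule LIMSEQ_le_const2[OF tendsto_norm[OF lim]]) (use K in auto)
  interpret finite_measure circle_measure by (rule finite_measure_circle)
  have F2: "F \<in> L2_circle"
  proof -
    have "integrable circle_measure (\<lambda>x. (cmod (F x))\<^sup>2)"
      by (rule integrable_const_bound[of _ "K\<^sup>2"]) (auto intro!: power_mono FK)
    then show ?thesis using mF by (simp add: L2_circle_def)
  qed
  have limF: "(\<lambda>n. integral\<^sup>L circle_measure (\<lambda>x. f n x * \<psi> x)) \<longlonglongrightarrow> integral\<^sup>L circle_measure (\<lambda>x. F x * \<psi> x)"
    if \<psi>: "continuous_periodic \<psi>" for \<psi>
  proof (rule integral_dominated_convergence)
    have c\<psi>: "continuous_on UNIV \<psi>" using \<psi> by (simp add: continuous_periodic_def)
    show "integrable circle_measure (\<lambda>x. K * cmod (\<psi> x))"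
      by (intro integrable_circle continuous_on_mult continuous_on_norm c\<psi> continuous_on_const)
    show "(\<lambda>x. F x * \<psi> x) \<in> borel_measurable circle_measure" "\<And>n. (\<lambda>x. f n x * \<psi> x) \<in> borel_measurable circle_measure"
      using measurable_continuous_circle[OF c\<psi>] by measurable
  qed (auto intro!: tendsto_mult lim mult_right_mono K simp: norm_mult)
  have "\<exists>g\<in>L2_circle. weak_derivative_circle \<alpha> F g" if \<alpha>: "\<alpha> \<in> {1..k}" for \<alpha>
  proof -
    obtain h where h: "L2_cauchy h" "\<And>\<phi> n. \<phi> \<in> smooth_periodic \<Longrightarrow>
      integral\<^sup>L circle_measure (\<lambda>\<theta>. f n \<theta> * nth_vector_derivative \<alpha> \<phi> \<theta>) =
      (-1) ^ \<alpha> * integral\<^sup>L circle_measure (\<lambda>\<theta>. h n \<theta> * \<phi> \<theta>)"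
      using L2_class_weak_derivative[OF f, of \<alpha>] \<alpha> by auto
    obtain g where g: "g \<in> L2_circle"
      "\<forall>e>0. \<exists>N. \<forall>n\<ge>N. integrable circle_measure (\<lambda>x. (cmod (h n x - g x))\<^sup>2) \<and>
      integral\<^sup>L circle_measure (\<lambda>x. (cmod (h n x - g x))\<^sup>2) \<le> e"
      using L2_complete[OF h(1)] by blast
    have "weak_derivative_circle \<alpha> F g"
      unfolding weak_derivative_circle_def
    proof
      fix \<phi> assume \<phi>: "\<phi> \<in> smooth_periodic"
      have "continuous_periodic \<phi>"
        using continuous_periodic_nth_vector_derivative[OF \<phi>, of 0] by (simp add: nth_vector_derivative_0)
      then have "(\<lambda>n. (-1) ^ \<alpha> * integral\<^sup>L circle_measure (\<lambda>\<theta>. h n \<theta> * \<phi> \<theta>)) \<longlonglongrightarrow>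
          (-1) ^ \<alpha> * integral\<^sup>L circle_measure (\<lambda>\<theta>. g \<theta> * \<phi> \<theta>)"
        by (intro tendsto_mult_left L2_limit_integral[OF h(1) g])
      moreover have "(\<lambda>n. (-1) ^ \<alpha> * integral\<^sup>L circle_measure (\<lambda>\<theta>. h n \<theta> * \<phi> \<theta>)) \<longlonglongrightarrow>
          integral\<^sup>L circle_measure (\<lambda>\<theta>. F \<theta> * nth_vector_derivative \<alpha> \<phi> \<theta>)"
        using limF[OF continuous_periodic_nth_vector_derivative[OF \<phi>, of \<alpha>]] h(2)[OF \<phi>] by simp
      ultimately show "integral\<^sup>L circle_measure (\<lambda>\<theta>. F \<theta> * nth_vector_derivative \<alpha> \<phi> \<theta>) =
          (-1) ^ \<alpha> * integral\<^sup>L circle_measure (\<lambda>\<theta>. g \<theta> * \<phi> \<theta>)"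
        by (rule LIMSEQ_unique[symmetric])
    qed
    then show ?thesis using g(1) by blast
  qed
  then show ?thesis using F2 by (simp add: sobolev_circle_def)
qed

section \<open>From the potential to the reflection coefficient\<close>

lemma L2_class_approx:
  assumes hR: "half_line (right_half q) j \<rho>" and hL: "half_line (left_half q) j \<rho>"
  shows "L2_class (Suc j) (\<lambda>n \<theta>. approx_b q n \<theta> / approx_a q n \<theta>)"
proof -
  interpret R: half_line "right_half q" j \<rho> by fact
  interpret L: half_line "left_half q" j \<rho> by fact
  note cls = R.L2_class_transfer L.L2_class_transfer
  have a: "L2_class (Suc j) (approx_a q)"
    unfolding approx_a_def[abs_def]
    by (intro L2_class_add[OF L2_class_mult[OF cls(1) cls(3)] L2_class_mult[OF L2_class_cnj[OF cls(2)] L2_class_cnj[OF cls(4)]]])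
  have b: "L2_class (Suc j) (approx_b q)"
    unfolding approx_b_def[abs_def]
    by (intro L2_class_add[OF L2_class_mult[OF cls(2) cls(3)] L2_class_mult[OF L2_class_cnj[OF cls(1)] L2_class_cnj[OF cls(4)]]])
  obtain \<delta> where \<delta>: "\<delta> > 0" "\<And>n \<theta>. \<delta> \<le> cmod (approx_a q n \<theta>)"
    using approx_a_lower_bound[OF hR hL] by metis
  show ?thesis
    unfolding divide_inverse by (rule L2_class_mult[OF b L2_class_inverse[OF \<delta> a]])
qed

text \<open>\<open>h\<close> enumerates one half line, as n or as -n - 1; both choices satisfy the
  condition on |2 h(n) + 1|, which makes the two weights comparable.\<close>

lemma l2_weighted_summable_odd:
  assumes q: "q \<in> l2_weighted k" and h: "inj h" and w: "\<And>n. \<bar>2 * real_of_int (h n) + 1\<bar> = 2 * real n + 1"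
  shows "summable (\<lambda>n. (cmod (q (h n)) * (2 * real n + 1) ^ k)\<^sup>2)"
proof (rule summable_comparison_test')
  have "(\<lambda>n. (1 + (real_of_int n)\<^sup>2) ^ k * (cmod (q n))\<^sup>2) summable_on range h"
    using q summable_on_subset_banach by (fastforce simp: l2_weighted_def)
  then have "((\<lambda>n. (1 + (real_of_int n)\<^sup>2) ^ k * (cmod (q n))\<^sup>2) \<circ> h) summable_on UNIV"
    using summable_on_reindex[OF h] by blast
  then have "summable ((\<lambda>n. (1 + (real_of_int n)\<^sup>2) ^ k * (cmod (q n))\<^sup>2) \<circ> h)"
    by (rule summable_on_imp_summable)
  then show "summable (\<lambda>n. 8 ^ k * ((1 + (real_of_int (h n))\<^sup>2) ^ k * (cmod (q (h n)))\<^sup>2))"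
    by (intro summable_mult) (simp add: o_def)
  show "norm ((cmod (q (h n)) * (2 * real n + 1) ^ k)\<^sup>2) \<le>
      8 ^ k * ((1 + (real_of_int (h n))\<^sup>2) ^ k * (cmod (q (h n)))\<^sup>2)" for n
  proof -
    let ?x = "real_of_int (h n)"
    have "(2 * real n + 1)\<^sup>2 = (2 * ?x + 1)\<^sup>2"
      using w[of n] by (metis power2_abs)
    \<comment> \<open>The right side minus the left is (2x - 1)^2 + 6.\<close>
    also have "\<dots> \<le> 8 * (1 + ?x\<^sup>2)"
      using zero_le_power2[of "2 * ?x - 1"] by (simp add: power2_eq_square algebra_simps)
    finally have "((2 * real n + 1)\<^sup>2) ^ k \<le> (8 * (1 + ?x\<^sup>2)) ^ k"
      by (rule power_mono) simp
    then have "((2 * real n + 1)\<^sup>2) ^ k * (cmod (q (h n)))\<^sup>2 \<le> (8 * (1 + ?x\<^sup>2)) ^ k * (cmod (q (h n)))\<^sup>2"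
      by (rule mult_right_mono) simp
    moreover have "norm ((cmod (q (h n)) * (2 * real n + 1) ^ k)\<^sup>2) = ((2 * real n + 1)\<^sup>2) ^ k * (cmod (q (h n)))\<^sup>2"
      by (simp add: power_mult_distrib power_mult[symmetric] mult.commute)
    ultimately show ?thesis by (simp only: power_mult_distrib mult.assoc)
  qed
qed

text \<open>The supremum controls single values only for a bounded family; weighted summability
  provides the boundedness.\<close>

lemma l2_weighted_bounded:
  assumes "q \<in> l2_weighted k"
  shows "bdd_above (range (\<lambda>n. cmod (q n)))"
proof -
  let ?f = "\<lambda>n. (1 + (real_of_int n)\<^sup>2) ^ k * (cmod (q n))\<^sup>2"
  have f: "?f summable_on UNIV" using assms by (simp add: l2_weighted_def)
  have "cmod (q n) \<le> 1 + infsum ?f UNIV" for n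
  proof -
    have "(cmod (q n))\<^sup>2 \<le> ?f n" by (simp add: mult_le_cancel_right1 one_le_power)
    also have "?f n = sum ?f {n}" by simp
    also have "\<dots> \<le> infsum ?f UNIV"
      by (rule finite_sum_le_infsum[OF f]) auto
    finally have "(cmod (q n))\<^sup>2 \<le> infsum ?f UNIV" .
    moreover have "cmod (q n) \<le> 1 + (cmod (q n))\<^sup>2"
      using young_square[of "cmod (q n)" 1 1] by simp
    ultimately show ?thesis by linarith
  qed
  then show ?thesis by (auto intro!: bdd_aboveI)
qed

theorem theorem2p5:
  fixes k :: nat and q :: "int \<Rightarrow> complex"
  assumes "k \<ge> 1"
    and "q \<in> l2_weighted k"
    and "(SUP n. cmod (q n)) < 1"
  shows "reflection_coeff q \<in> sobolev_circle k"
proof -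
  \<comment> \<open>Orders up to \<open>j\<close> converge uniformly and order \<open>Suc j\<close>
    in mean square.\<close>
  obtain j where j: "k = Suc j" using assms(1) by (cases k) auto
  define \<rho> where "\<rho> = (SUP n. cmod (q n))"
  have \<rho>: "cmod (q n) \<le> \<rho>" for n
    unfolding \<rho>_def by (rule cSUP_upper[OF _ l2_weighted_bounded[OF assms(2)]]) simp
  have hR: "half_line (right_half q) j \<rho>"
  proof
    show "summable (\<lambda>n. (cmod (right_half q n) * (2 * real n + 1) ^ Suc j)\<^sup>2)"
      using l2_weighted_summable_odd[OF assms(2), of int] unfolding right_half_def j by simp
  qed (use \<rho> assms(3) in \<open>auto simp: right_half_def \<rho>_def\<close>)
  have hL: "half_line (left_half q) j \<rho>"
  proof
    have "summable (\<lambda>n. (cmod (q (- int n - 1)) * (2 * real n + 1) ^ Suc j)\<^sup>2)"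
      using l2_weighted_summable_odd[OF assms(2), of "\<lambda>n. - int n - 1"] unfolding j
      by (simp add: inj_def)
    then show "summable (\<lambda>n. (cmod (left_half q n) * (2 * real n + 1) ^ Suc j)\<^sup>2)"
      unfolding left_half_def by simp
  qed (use \<rho> assms(3) in \<open>auto simp: left_half_def \<rho>_def\<close>)
  show ?thesis
    by (rule L2_class_limit_in_sobolev[OF L2_class_approx[OF hR hL, folded j] assms(1)
          reflection_coeff_limit[OF hR hL]])
qed

end
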